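(* For every $n\ge1$, the set $\{\Theta(T): T\in\mathcal{T}Lyn_n^\bullet\}$ is a basis of $\mathcal{P}re\mathcal{L}ie(n)$.
   Context: A pre-Lie algebra is a vector space $V$ with a bilinear operation $\circ$ satisfying $(v\circ w)\circ z-v\circ(w\circ z)=(v\circ z)\circ w-v\circ(z\circ w)$ for all $v,w,z\in V$. $\mathcal{P}re\mathcal{L}ie(n)$ is the multilinear component of the free pre-Lie algebra on generators $1,\dots,n$ (the span of monomials in which each generator appears exactly once). Trees: a bicolored binary tree on $[n]$ is a rooted planar binary tree (left child $L(v)$, right child $R(v)$ of each internal vertex) with leaves bijectively labeled by $[n]$ and internal vertices colored in $\{0,1\}$. $\nu(v)$ is the smallest leaf label below $v$; normalized means $\nu(v)=\nu(L(v))$ for all internal $v$; $v$ is Lyndon if $L(v)$ is a leaf or $\nu(R(L(v)))>\nu(R(v))$. A normalized bicolored binary tree is a pointed Lyndon tree if every internal $v$ with internal left child satisfies $\mathrm{color}(L(v))\ge\mathrm{color}(v)$ and, when $\mathrm{color}(L(v))=\mathrm{color}(v)=1$, $v$ is Lyndon. $\mathcal{T}Lyn_n^\bullet$ denotes the set of pointed Lyndon trees with leaf label set $[n]$. Writing $T=T_L\wedge^u T_R$ for a tree with left subtree $T_L$, right subtree $T_R$ and root color $u$, define $\Theta(T)\in\mathcal{P}re\mathcal{L}ie(n)$ recursively by $\Theta(a)=a$ for a single leaf $a$, $\Theta(T)=\Theta(T_L)\circ\Theta(T_R)$ if $u=1$, and $\Theta(T)=\Theta(T_R)\circ\Theta(T_L)$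 if $u=0$. *)

theory Defs
  imports Complex_Main "HOL-Library.Poly_Mapping" "HOL-Library.Multiset"
begin

section \<open>Pre-Lie algebras\<close>

locale pre_lie_algebra = vector_space scale
  for scale :: "'k::field \<Rightarrow> 'v::ab_group_add \<Rightarrow> 'v" +
  fixes mul :: "'v \<Rightarrow> 'v \<Rightarrow> 'v"
  assumes linear_mul_left: "Vector_Spaces.linear scale scale (\<lambda>v. mul v w)"
    and linear_mul_right: "Vector_Spaces.linear scale scale (\<lambda>w. mul v w)"
    and pre_lie: "mul (mul v w) z - mul v (mul w z) = mul (mul v z) w - mul v (mul z w)"
begin

lemmas mul_add_left = module_hom.add[OF Vector_Spaces.linear.axioms(3)[OF linear_mul_left]]
lemmas mul_add_right = module_hom.add[OF Vector_Spaces.linear.axioms(3)[OF linear_mul_right]]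
lemmas mul_scale_left = module_hom.scale[OF Vector_Spaces.linear.axioms(3)[OF linear_mul_left]]
lemmas mul_scale_right = module_hom.scale[OF Vector_Spaces.linear.axioms(3)[OF linear_mul_right]]
lemmas mul_sum_left = module_hom.sum[OF Vector_Spaces.linear.axioms(3)[OF linear_mul_left]]
lemmas mul_sum_right = module_hom.sum[OF Vector_Spaces.linear.axioms(3)[OF linear_mul_right]]

end


section \<open>The free pre-Lie algebra\<close>

text \<open>
  The free pre-Lie algebra on the generators \<open>'a\<close> over the field \<open>'k\<close> is the free nonassociative
  algebra (finitely supported functions on the free magma \<open>'a magma\<close>) modulo the two-sided ideal
  generated by the pre-Lie relators.
\<close>

datatype 'a magma = Gen 'a | Mul "'a magma" "'a magma"

primrec generators :: "'a magma \<Rightarrow> 'a multiset" where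
  "generators (Gen a) = {#a#}"
| "generators (Mul s t) = generators s + generators t"

lift_definition magma_mult ::
  "('a magma \<Rightarrow>\<^sub>0 'k::field) \<Rightarrow> ('a magma \<Rightarrow>\<^sub>0 'k) \<Rightarrow> ('a magma \<Rightarrow>\<^sub>0 'k)"
  is "\<lambda>p q u. case u of Gen a \<Rightarrow> 0 | Mul s t \<Rightarrow> p s * q t"
proof -
  fix p q :: "'a magma \<Rightarrow> 'k"
  assume "finite {s. p s \<noteq> 0}" "finite {t. q t \<noteq> 0}"
  moreover have "{u. (case u of Gen a \<Rightarrow> 0 | Mul s t \<Rightarrow> p s * q t) \<noteq> 0}
      \<subseteq> (\<lambda>(s, t). Mul s t) ` ({s. p s \<noteq> 0} \<times> {t. q t \<noteq> 0})"
    by (force split: magma.splits)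
  ultimately show "finite {u. (case u of Gen a \<Rightarrow> 0 | Mul s t \<Rightarrow> p s * q t) \<noteq> 0}"
    by (meson finite_SigmaI finite_imageI finite_subset)
qed

definition magma_scale :: "'k::field \<Rightarrow> ('a magma \<Rightarrow>\<^sub>0 'k) \<Rightarrow> ('a magma \<Rightarrow>\<^sub>0 'k)" where
  "magma_scale c p = Poly_Mapping.map ((*) c) p"

lemma lookup_magma_scale [simp]:
  "Poly_Mapping.lookup (magma_scale c p) s = c * Poly_Mapping.lookup p s"
  unfolding magma_scale_def by transfer (simp add: when_def)

inductive_set pre_lie_ideal :: "('a magma \<Rightarrow>\<^sub>0 'k::field) set" where
  relator: "(magma_mult (magma_mult p q) r - magma_mult p (magma_mult q r))
    - (magma_mult (magma_mult p r) q - magma_mult p (magma_mult r q)) \<in> pre_lie_ideal"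
| add: "p \<in> pre_lie_ideal \<Longrightarrow> q \<in> pre_lie_ideal \<Longrightarrow> p + q \<in> pre_lie_ideal"
| scale: "p \<in> pre_lie_ideal \<Longrightarrow> magma_scale c p \<in> pre_lie_ideal"
| mult_left: "p \<in> pre_lie_ideal \<Longrightarrow> magma_mult q p \<in> pre_lie_ideal"
| mult_right: "p \<in> pre_lie_ideal \<Longrightarrow> magma_mult p q \<in> pre_lie_ideal"

lemma magma_mult_add_left: "magma_mult (p + p') q = magma_mult p q + magma_mult p' q"
  by (rule poly_mapping_eqI)
     (simp add: magma_mult.rep_eq lookup_add algebra_simps split: magma.splits)

lemma magma_mult_add_right: "magma_mult p (q + q') = magma_mult p q + magma_mult p q'"
  by (rule poly_mapping_eqI)
     (simp add: magma_mult.rep_eq lookup_add algebra_simps split: magma.splits)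

lemma magma_mult_diff_left: "magma_mult (p - p') q = magma_mult p q - magma_mult p' q"
  by (rule poly_mapping_eqI)
     (simp add: magma_mult.rep_eq lookup_minus algebra_simps split: magma.splits)

lemma magma_mult_diff_right: "magma_mult p (q - q') = magma_mult p q - magma_mult p q'"
  by (rule poly_mapping_eqI)
     (simp add: magma_mult.rep_eq lookup_minus algebra_simps split: magma.splits)

lemma magma_mult_scale_left: "magma_mult (magma_scale c p) q = magma_scale c (magma_mult p q)"
  by (rule poly_mapping_eqI) (simp add: magma_mult.rep_eq split: magma.splits)

lemma magma_mult_scale_right: "magma_mult p (magma_scale c q) = magma_scale c (magma_mult p q)"
  by (rule poly_mapping_eqI) (simp add: magma_mult.rep_eq split: magma.splits)

lemma magma_scale_diff: "magma_scale c (p - q) = magma_scale c p - magma_scale c q"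
  by (rule poly_mapping_eqI) (simp add: lookup_minus algebra_simps)

lemma magma_scale_minus_one: "magma_scale (- 1) p = - p"
  by (rule poly_mapping_eqI) simp

lemma magma_scale_zero: "magma_scale 0 p = 0"
  by (rule poly_mapping_eqI) simp

lemma pre_lie_ideal_zero: "0 \<in> pre_lie_ideal"
  using pre_lie_ideal.scale[OF pre_lie_ideal.relator, of 0] by (simp add: magma_scale_zero)

lemma pre_lie_ideal_uminus: "p \<in> pre_lie_ideal \<Longrightarrow> - p \<in> pre_lie_ideal"
  using pre_lie_ideal.scale[of p "- 1"] by (simp add: magma_scale_minus_one)

quotient_type (overloaded) ('a, 'k) free_pre_lie = "'a magma \<Rightarrow>\<^sub>0 'k::field" /
  "\<lambda>p q. p - q \<in> pre_lie_ideal"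
proof (rule equivpI)
  show "reflp (\<lambda>p q :: 'a magma \<Rightarrow>\<^sub>0 'k. p - q \<in> pre_lie_ideal)"
    by (simp add: reflp_def pre_lie_ideal_zero)
  show "symp (\<lambda>p q :: 'a magma \<Rightarrow>\<^sub>0 'k. p - q \<in> pre_lie_ideal)"
    using pre_lie_ideal_uminus by (fastforce simp: symp_def)
  show "transp (\<lambda>p q :: 'a magma \<Rightarrow>\<^sub>0 'k. p - q \<in> pre_lie_ideal)"
    using pre_lie_ideal.add by (fastforce simp: transp_def)
qed

instantiation free_pre_lie :: (type, field) ab_group_add
begin

lift_definition zero_free_pre_lie :: "('a, 'b) free_pre_lie" is 0 .

lift_definition plus_free_pre_lie ::
  "('a, 'b) free_pre_lie \<Rightarrow> ('a, 'b) free_pre_lie \<Rightarrow> ('a, 'b) free_pre_lie" is "(+)"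
  by (metis add_diff_add pre_lie_ideal.add)

lift_definition uminus_free_pre_lie :: "('a, 'b) free_pre_lie \<Rightarrow> ('a, 'b) free_pre_lie" is uminus
  by (metis minus_diff_minus pre_lie_ideal_uminus)

lift_definition minus_free_pre_lie ::
  "('a, 'b) free_pre_lie \<Rightarrow> ('a, 'b) free_pre_lie \<Rightarrow> ('a, 'b) free_pre_lie" is "(-)"
proof -
  fix p p' q q' :: "'a magma \<Rightarrow>\<^sub>0 'b"
  assume "p - p' \<in> pre_lie_ideal" "q - q' \<in> pre_lie_ideal"
  then have "(p - p') + - (q - q') \<in> pre_lie_ideal"
    by (intro pre_lie_ideal.add pre_lie_ideal_uminus)
  then show "p - q - (p' - q') \<in> pre_lie_ideal"
    by (simp add: algebra_simps)
qed

instance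
  by standard (transfer; simp add: algebra_simps pre_lie_ideal_zero)+

end

lift_definition free_scale :: "'k::field \<Rightarrow> ('a, 'k) free_pre_lie \<Rightarrow> ('a, 'k) free_pre_lie"
  is magma_scale
  by (metis magma_scale_diff pre_lie_ideal.scale)

lift_definition free_prod ::
  "('a, 'k::field) free_pre_lie \<Rightarrow> ('a, 'k) free_pre_lie \<Rightarrow> ('a, 'k) free_pre_lie"
  (infixl \<open>\<circ>\<^sub>P\<close> 70)
  is magma_mult
proof -
  fix p p' q q' :: "'a magma \<Rightarrow>\<^sub>0 'k"
  assume "p - p' \<in> pre_lie_ideal" "q - q' \<in> pre_lie_ideal"
  then have "magma_mult (p - p') q + magma_mult p' (q - q') \<in> pre_lie_ideal"
    by (intro pre_lie_ideal.add pre_lie_ideal.mult_left pre_lie_ideal.mult_right)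
  then show "magma_mult p q - magma_mult p' q' \<in> pre_lie_ideal"
    by (simp add: magma_mult_diff_left magma_mult_diff_right)
qed

lift_definition free_gen :: "'a \<Rightarrow> ('a, 'k::field) free_pre_lie"
  is "\<lambda>a. Poly_Mapping.single (Gen a) 1" .

primrec free_monomial :: "'a magma \<Rightarrow> ('a, 'k::field) free_pre_lie" where
  "free_monomial (Gen a) = free_gen a"
| "free_monomial (Mul s t) = free_monomial s \<circ>\<^sub>P free_monomial t"

lemma vector_space_free_scale:
  "vector_space (free_scale :: 'k::field \<Rightarrow> ('a, 'k) free_pre_lie \<Rightarrow> _)"
proof
  fix a b :: 'k and x y :: "('a, 'k) free_pre_lie"
  have eq: "p = q \<Longrightarrow> p - q \<in> pre_lie_ideal" for p q :: "'a magma \<Rightarrow>\<^sub>0 'k"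
    by (simp add: pre_lie_ideal_zero)
  show "free_scale a (x + y) = free_scale a x + free_scale a y"
    by transfer (rule eq, rule poly_mapping_eqI, simp add: lookup_add algebra_simps)
  show "free_scale (a + b) x = free_scale a x + free_scale b x"
    by transfer (rule eq, rule poly_mapping_eqI, simp add: lookup_add algebra_simps)
  show "free_scale a (free_scale b x) = free_scale (a * b) x"
    by transfer (rule eq, rule poly_mapping_eqI, simp add: mult.assoc)
  show "free_scale 1 x = x"
    by transfer (rule eq, rule poly_mapping_eqI, simp add: mult.assoc)
qed

global_interpretation free_pre_lie:
  pre_lie_algebra "free_scale :: 'k::field \<Rightarrow> ('a, 'k) free_pre_lie \<Rightarrow> _" free_prod
proof -
  interpret vector_space "free_scale :: 'k \<Rightarrow> ('a, 'k) free_pre_lie \<Rightarrow> _"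
    by (rule vector_space_free_scale)
  show "pre_lie_algebra (free_scale :: 'k \<Rightarrow> ('a, 'k) free_pre_lie \<Rightarrow> _) free_prod"
  proof
    fix v w z x y :: "('a, 'k) free_pre_lie" and c :: 'k
    show "(x + y) \<circ>\<^sub>P w = x \<circ>\<^sub>P w + y \<circ>\<^sub>P w"
      by transfer (simp add: pre_lie_ideal_zero magma_mult_add_left)
    show "w \<circ>\<^sub>P (x + y) = w \<circ>\<^sub>P x + w \<circ>\<^sub>P y"
      by transfer (simp add: pre_lie_ideal_zero magma_mult_add_right)
    show "free_scale c x \<circ>\<^sub>P w = free_scale c (x \<circ>\<^sub>P w)"
      by transfer (simp add: pre_lie_ideal_zero magma_mult_scale_left)
    show "w \<circ>\<^sub>P free_scale c x = free_scale c (w \<circ>\<^sub>P x)"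
      by transfer (simp add: pre_lie_ideal_zero magma_mult_scale_right)
    show "v \<circ>\<^sub>P w \<circ>\<^sub>P z - v \<circ>\<^sub>P (w \<circ>\<^sub>P z) = v \<circ>\<^sub>P z \<circ>\<^sub>P w - v \<circ>\<^sub>P (z \<circ>\<^sub>P w)"
      by transfer (rule pre_lie_ideal.relator)
  qed
qed

text \<open>
  For a set \<open>X\<close> of generators, the subalgebra generated by \<open>X\<close> is the free pre-Lie algebra on \<open>X\<close>:
  it has the universal property, see \<open>free_pre_lie_on_universal\<close> below.
\<close>

inductive_set free_pre_lie_on :: "'a set \<Rightarrow> ('a, 'k::field) free_pre_lie set" for X where
  gen: "a \<in> X \<Longrightarrow> free_gen a \<in> free_pre_lie_on X"
| zero: "0 \<in> free_pre_lie_on X"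
| add: "x \<in> free_pre_lie_on X \<Longrightarrow> y \<in> free_pre_lie_on X \<Longrightarrow> x + y \<in> free_pre_lie_on X"
| scale: "x \<in> free_pre_lie_on X \<Longrightarrow> free_scale c x \<in> free_pre_lie_on X"
| mul: "x \<in> free_pre_lie_on X \<Longrightarrow> y \<in> free_pre_lie_on X \<Longrightarrow> x \<circ>\<^sub>P y \<in> free_pre_lie_on X"

context pre_lie_algebra
begin

primrec eval_magma :: "('a \<Rightarrow> 'v) \<Rightarrow> 'a magma \<Rightarrow> 'v" where
  "eval_magma f (Gen a) = f a"
| "eval_magma f (Mul s t) = mul (eval_magma f s) (eval_magma f t)"

definition eval_poly :: "('a \<Rightarrow> 'v) \<Rightarrow> ('a magma \<Rightarrow>\<^sub>0 'k) \<Rightarrow> 'v" where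
  "eval_poly f p = (\<Sum>s\<in>Poly_Mapping.keys p. scale (Poly_Mapping.lookup p s) (eval_magma f s))"

lemma eval_poly_superset:
  assumes "finite A" "Poly_Mapping.keys p \<subseteq> A"
  shows "eval_poly f p = (\<Sum>s\<in>A. scale (Poly_Mapping.lookup p s) (eval_magma f s))"
  unfolding eval_poly_def
  using assms by (intro sum.mono_neutral_left) (auto simp: in_keys_iff)

lemma eval_poly_single: "eval_poly f (Poly_Mapping.single s c) = scale c (eval_magma f s)"
  by (subst eval_poly_superset[of "{s}"]) auto

lemma eval_poly_add: "eval_poly f (p + q) = eval_poly f p + eval_poly f q"
proof -
  let ?A = "Poly_Mapping.keys p \<union> Poly_Mapping.keys q"
  have "Poly_Mapping.keys (p + q) \<subseteq> ?A"
    by (rule keys_add)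
  then show ?thesis
    by (simp add: eval_poly_superset[of ?A] lookup_add scale_left_distrib sum.distrib)
qed

lemma eval_poly_scale: "eval_poly f (magma_scale c p) = scale c (eval_poly f p)"
proof -
  have "Poly_Mapping.keys (magma_scale c p) \<subseteq> Poly_Mapping.keys p"
    by (auto simp: in_keys_iff)
  then show ?thesis
    by (simp add: eval_poly_superset[of "Poly_Mapping.keys p"] scale_sum_right)
qed

lemma eval_poly_diff: "eval_poly f (p - q) = eval_poly f p - eval_poly f q"
  using eval_poly_add[of f "p - q" q] by (simp add: algebra_simps)

lemma eval_poly_mult: "eval_poly f (magma_mult p q) = mul (eval_poly f p) (eval_poly f q)"
proof -
  let ?m = "\<lambda>(s, t). Mul s t"
  let ?A = "Poly_Mapping.keys p \<times> Poly_Mapping.keys q"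
  have "Poly_Mapping.keys (magma_mult p q) \<subseteq> ?m ` ?A"
    by (force simp: in_keys_iff magma_mult.rep_eq split: magma.splits)
  then have "eval_poly f (magma_mult p q) =
      (\<Sum>u\<in>?m ` ?A. scale (Poly_Mapping.lookup (magma_mult p q) u) (eval_magma f u))"
    by (intro eval_poly_superset) auto
  also have "\<dots> = (\<Sum>(s, t)\<in>?A. scale (Poly_Mapping.lookup p s * Poly_Mapping.lookup q t)
      (mul (eval_magma f s) (eval_magma f t)))"
    by (subst sum.reindex) (auto simp: inj_on_def magma_mult.rep_eq intro!: sum.cong)
  also have "\<dots> = (\<Sum>s\<in>Poly_Mapping.keys p. \<Sum>t\<in>Poly_Mapping.keys q.
      scale (Poly_Mapping.lookup p s * Poly_Mapping.lookup q t)
        (mul (eval_magma f s) (eval_magma f t)))"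
    by (rule sum.cartesian_product[symmetric])
  also have "\<dots> = mul (eval_poly f p) (eval_poly f q)"
    unfolding eval_poly_def
    by (subst sum.swap) (simp only: mul_sum_left mul_sum_right mul_scale_left mul_scale_right
        scale_scale scale_sum_right mult.commute)
  finally show ?thesis .
qed

lemma eval_poly_ideal: "p \<in> pre_lie_ideal \<Longrightarrow> eval_poly f p = 0"
proof (induction rule: pre_lie_ideal.induct)
  case (relator p q r)
  then show ?case
    using pre_lie by (simp add: eval_poly_diff eval_poly_mult)
next
  case (mult_left p q)
  then show ?case
    using mul_scale_right[of _ 0 0] by (simp add: eval_poly_mult)
next
  case (mult_right p q)
  then show ?case
    using mul_scale_left[of 0 0] by (simp add: eval_poly_mult)
qed (simp_all add: eval_poly_add eval_poly_scale)

end

definition pre_lie_hom_on ::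
  "('k::field \<Rightarrow> 'v::ab_group_add \<Rightarrow> 'v) \<Rightarrow> ('v \<Rightarrow> 'v \<Rightarrow> 'v) \<Rightarrow> ('a, 'k) free_pre_lie set
    \<Rightarrow> (('a, 'k) free_pre_lie \<Rightarrow> 'v) \<Rightarrow> bool" where
  "pre_lie_hom_on scale mul S h \<longleftrightarrow>
    (\<forall>x\<in>S. \<forall>y\<in>S. h (x + y) = h x + h y) \<and>
    (\<forall>c. \<forall>x\<in>S. h (free_scale c x) = scale c (h x)) \<and>
    (\<forall>x\<in>S. \<forall>y\<in>S. h (x \<circ>\<^sub>P y) = mul (h x) (h y))"

theorem free_pre_lie_on_universal:
  fixes scale :: "'k::field \<Rightarrow> 'v::ab_group_add \<Rightarrow> 'v" and f :: "'a \<Rightarrow> 'v" and X :: "'a set"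
  assumes "pre_lie_algebra scale mul"
  shows "\<exists>h. pre_lie_hom_on scale mul (free_pre_lie_on X) h \<and> (\<forall>a\<in>X. h (free_gen a) = f a)"
    and "\<lbrakk>pre_lie_hom_on scale mul (free_pre_lie_on X) h; \<forall>a\<in>X. h (free_gen a) = f a;
          pre_lie_hom_on scale mul (free_pre_lie_on X) h'; \<forall>a\<in>X. h' (free_gen a) = f a\<rbrakk>
        \<Longrightarrow> x \<in> free_pre_lie_on X \<Longrightarrow> h x = h' x"
proof -
  interpret pre_lie_algebra scale mul by fact
  define h where "h x = eval_poly f (rep_free_pre_lie x)" for x :: "('a, 'k) free_pre_lie"
  have h: "h (abs_free_pre_lie p) = eval_poly f p" for p
  proof -
    have "rep_free_pre_lie (abs_free_pre_lie p) - p \<in> pre_lie_ideal"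
      by (metis Quotient_free_pre_lie Quotient_rep_abs_eq Quotient_abs_rep
          free_pre_lie.abs_eq_iff)
    then show ?thesis
      unfolding h_def using eval_poly_ideal[of _ f] by (metis eval_poly_diff eq_iff_diff_eq_0)
  qed
  have ind: "P (abs_free_pre_lie (rep_free_pre_lie x)) \<Longrightarrow> P x"
    for P and x :: "('a, 'k) free_pre_lie"
    by (metis Quotient_abs_rep[OF Quotient_free_pre_lie])
  have "h (x + y) = h x + h y" for x y
    by (rule ind[of _ x], rule ind[of _ y])
       (simp only: plus_free_pre_lie.abs_eq h eval_poly_add)
  moreover have "h (free_scale c x) = scale c (h x)" for c x
    by (rule ind[of _ x]) (simp only: free_scale.abs_eq h eval_poly_scale)
  moreover have "h (x \<circ>\<^sub>P y) = mul (h x) (h y)" for x y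
    by (rule ind[of _ x], rule ind[of _ y]) (simp only: free_prod.abs_eq h eval_poly_mult)
  moreover have "h (free_gen a) = f a" for a
    by (simp add: free_gen_def h eval_poly_single)
  ultimately show "\<exists>h. pre_lie_hom_on scale mul (free_pre_lie_on X) h \<and>
      (\<forall>a\<in>X. h (free_gen a) = f a)"
    unfolding pre_lie_hom_on_def by blast
next
  interpret pre_lie_algebra scale mul by fact
  assume hom: "pre_lie_hom_on scale mul (free_pre_lie_on X) h" "\<forall>a\<in>X. h (free_gen a) = f a"
    "pre_lie_hom_on scale mul (free_pre_lie_on X) h'" "\<forall>a\<in>X. h' (free_gen a) = f a"
  have "g 0 = 0" if "pre_lie_hom_on scale mul (free_pre_lie_on X) g" for g
    using that free_pre_lie_on.zero[of X] unfolding pre_lie_hom_on_def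
    by (metis add_cancel_right_left)
  note zero = this[OF hom(1)] this[OF hom(3)]
  show "x \<in> free_pre_lie_on X \<Longrightarrow> h x = h' x"
    by (induction rule: free_pre_lie_on.induct)
       (use hom zero in \<open>simp_all add: pre_lie_hom_on_def\<close>)
qed

text \<open>
  The multilinear component on the generators \<open>1, \<dots>, n\<close>, as a subspace of the free pre-Lie algebra
  on all natural numbers; it lies in its free subalgebra on \<open>1, \<dots>, n\<close>.
\<close>

definition PreLie :: "nat \<Rightarrow> (nat, 'k::field) free_pre_lie set" where
  "PreLie n = free_pre_lie.span {free_monomial m |m. generators m = mset_set {1..n}}"

lemma free_monomial_in_free_pre_lie_on:
  "set_mset (generators m) \<subseteq> X \<Longrightarrow> free_monomial m \<in> free_pre_lie_on X"
  by (induction m) (auto intro: free_pre_lie_on.intros)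

lemma PreLie_subset: "PreLie n \<subseteq> free_pre_lie_on {1..n}"
  unfolding PreLie_def
  by (rule free_pre_lie.span_minimal)
     (auto simp: free_pre_lie.subspace_def
       intro: free_pre_lie_on.intros free_monomial_in_free_pre_lie_on)

definition basis_of :: "('a, 'k::field) free_pre_lie set \<Rightarrow> ('a, 'k) free_pre_lie set \<Rightarrow> bool" where
  "basis_of B V \<longleftrightarrow> free_pre_lie.independent B \<and> free_pre_lie.span B = V"


section \<open>Pointed Lyndon trees\<close>

text \<open>Colors are Booleans, with \<open>False\<close> for 0 and \<open>True\<close> for 1, so that \<open>\<le>\<close> is the order on colors.\<close>

datatype bctree = Leaf nat | Node (left: bctree) (color: bool) (right: bctree)

primrec leaves :: "bctree \<Rightarrow> nat multiset" where
  "leaves (Leaf a) = {#a#}"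
| "leaves (Node l u r) = leaves l + leaves r"

definition bicolored_tree_on :: "nat set \<Rightarrow> bctree \<Rightarrow> bool" where
  "bicolored_tree_on A T \<longleftrightarrow> leaves T = mset_set A"

text \<open>A vertex of a tree is represented by the subtree hanging from it.\<close>

primrec subtrees :: "bctree \<Rightarrow> bctree set" where
  "subtrees (Leaf a) = {Leaf a}"
| "subtrees (Node l u r) = insert (Node l u r) (subtrees l \<union> subtrees r)"

abbreviation is_internal :: "bctree \<Rightarrow> bool" where
  "is_internal v \<equiv> \<not> is_Leaf v"

definition internal_vertices :: "bctree \<Rightarrow> bctree set" where
  "internal_vertices T = {v \<in> subtrees T. is_internal v}"

definition min_leaf :: "bctree \<Rightarrow> nat" (\<open>\<nu>\<close>) where
  "\<nu> v = Min (set_mset (leaves v))"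

definition normalized :: "bctree \<Rightarrow> bool" where
  "normalized T \<longleftrightarrow> (\<forall>v\<in>internal_vertices T. \<nu> v = \<nu> (left v))"

definition Lyndon :: "bctree \<Rightarrow> bool" where
  "Lyndon v \<longleftrightarrow> is_Leaf (left v) \<or> \<nu> (right (left v)) > \<nu> (right v)"

definition pointed_Lyndon :: "bctree \<Rightarrow> bool" where
  "pointed_Lyndon T \<longleftrightarrow> normalized T \<and>
    (\<forall>v\<in>internal_vertices T. is_internal (left v) \<longrightarrow>
      color (left v) \<ge> color v \<and> (color (left v) = True \<and> color v = True \<longrightarrow> Lyndon v))"

definition TLyn :: "nat \<Rightarrow> bctree set" where
  "TLyn n = {T. bicolored_tree_on {1..n} T \<and> pointed_Lyndon T}"

primrec Theta :: "bctree \<Rightarrow> (nat, 'k::field) free_pre_lie" where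
  "Theta (Leaf a) = free_gen a"
| "Theta (Node l u r) = (if u then Theta l \<circ>\<^sub>P Theta r else Theta r \<circ>\<^sub>P Theta l)"

end

(*
  Order the rooted trees on a label set by total depth. In the pre-Lie algebra of rooted trees, the
  expansion of a monomial has a unique term of minimal depth, obtained by grafting at the root in
  every product, and its coefficient is 1. Passing to these leading terms turns the pre-Lie identity
  into the relation (x y) z = (x z) y. A pointed Lyndon tree with smallest leaf a encodes the
  path from the root to a of its leading tree: the right subtrees below vertices of color 1 are the
  branches at a, sorted by their minima, and those below vertices of color 0 are the remaining
  branches along the path. So the leading tree determines the pointed Lyndon tree (independence),
  and every monomial is brought into pointed Lyndon form modulo monomials of larger depth (spanning).
*)
theory Submission
  imports Defs
begin

section \<open>The pre-Lie algebra of rooted trees\<close>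

definition tree_scale :: "'k::field \<Rightarrow> ('a rel \<Rightarrow>\<^sub>0 'k) \<Rightarrow> ('a rel \<Rightarrow>\<^sub>0 'k)" where
  "tree_scale c p = Poly_Mapping.map ((*) c) p"

lemma lookup_tree_scale [simp]:
  "Poly_Mapping.lookup (tree_scale c p) x = c * Poly_Mapping.lookup p x"
  unfolding tree_scale_def by transfer (simp add: when_def)

lemma vector_space_tree_scale: "vector_space tree_scale"
  by standard (auto intro!: poly_mapping_eqI simp: lookup_add algebra_simps)

global_interpretation tree: vector_space tree_scale
  by (rule vector_space_tree_scale)

lemma tree_scale_single: "tree_scale c (Poly_Mapping.single x d) = Poly_Mapping.single x (c * d)"
  by (rule poly_mapping_eqI) (simp add: lookup_single when_def)

text \<open>
  A rooted tree is represented by the ancestor relation of its vertices: \<open>(u, v) \<in> x\<close> if \<open>u\<close> lies on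
  the path from the root to \<open>v\<close>, endpoints included. Its cardinality is the total depth. The pre-Lie
  identity only needs the relations to be finite with disjoint fields, so arbitrary relations are
  allowed here.
\<close>

definition anc :: "'a rel \<Rightarrow> 'a \<Rightarrow> 'a set" where
  "anc x v = {u. (u, v) \<in> x}"

text \<open>Hanging the root of \<open>y\<close> below \<open>v\<close> by an edge makes the
  ancestors of \<open>v\<close>, including \<open>v\<close>, ancestors of every vertex of
  \<open>y\<close>.\<close>

definition graft :: "'a rel \<Rightarrow> 'a \<Rightarrow> 'a rel \<Rightarrow> 'a rel" where
  "graft x v y = x \<union> y \<union> anc x v \<times> Field y"

lemma anc_subset_Field: "anc x v \<subseteq> Field x"
  by (auto simp: anc_def Field_def)

lemma Field_graft: "Field (graft x v y) = Field x \<union> Field y"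
  by (auto simp: graft_def anc_def Field_def)

lemma finite_graft_iff: "finite (graft x v y) \<longleftrightarrow> finite x \<and> finite y"
  by (auto simp: graft_def intro: finite_subset[OF anc_subset_Field] finite_Field)

lemma anc_graft_left:
  "Field x \<inter> Field y = {} \<Longrightarrow> u \<in> Field x \<Longrightarrow> anc (graft x v y) u = anc x u"
  by (auto simp: graft_def anc_def Field_def)

lemma anc_graft_right:
  "Field x \<inter> Field y = {} \<Longrightarrow> u \<in> Field y \<Longrightarrow> anc (graft x v y) u = anc y u \<union> anc x v"
  by (auto simp: graft_def anc_def Field_def)

text \<open>Grafting \<open>y\<close> adds no ancestors to vertices of \<open>x\<close>, so two
  graftings onto \<open>x\<close> do not see each other.\<close>

lemma graft_commute:
  assumes "Field x \<inter> Field y = {}" "Field x \<inter> Field z = {}" "u \<in> Field x" "v \<in> Field x"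
  shows "graft (graft x v y) u z = graft (graft x u z) v y"
  unfolding graft_def[of "graft x v y"] graft_def[of "graft x u z"]
  by (simp add: anc_graft_left assms) (auto simp: graft_def)

text \<open>In either order the vertices of \<open>z\<close> receive the ancestors of
  \<open>u\<close> in \<open>y\<close> together with those of \<open>v\<close> in
  \<open>x\<close>.\<close>

lemma graft_assoc:
  assumes "Field x \<inter> Field y = {}" "u \<in> Field y"
  shows "graft (graft x v y) u z = graft x v (graft y u z)"
  unfolding graft_def[of "graft x v y"] graft_def[of x v "graft y u z"]
  by (simp add: anc_graft_right Field_graft assms) (auto simp: graft_def)

text \<open>The product of two basis elements. The default value 0 for infinite or overlapping
  relations makes it total and keeps the pre-Lie identity valid for arbitrary relations.\<close>

definition graft_sum :: "'a rel \<Rightarrow> 'a rel \<Rightarrow> ('a rel \<Rightarrow>\<^sub>0 'k::field)" where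
  "graft_sum x y = (if finite x \<and> finite y \<and> Field x \<inter> Field y = {}
     then \<Sum>v\<in>Field x. Poly_Mapping.single (graft x v y) 1 else 0)"

definition tree_mult :: "('a rel \<Rightarrow>\<^sub>0 'k::field) \<Rightarrow> ('a rel \<Rightarrow>\<^sub>0 'k) \<Rightarrow> ('a rel \<Rightarrow>\<^sub>0 'k)" where
  "tree_mult p q = (\<Sum>x\<in>Poly_Mapping.keys p. \<Sum>y\<in>Poly_Mapping.keys q.
     tree_scale (Poly_Mapping.lookup p x * Poly_Mapping.lookup q y) (graft_sum x y))"

section \<open>Bilinearity of the product on formal sums of trees\<close>

lemma tree_mult_superset:
  assumes "finite A" "Poly_Mapping.keys p \<subseteq> A" "finite B" "Poly_Mapping.keys q \<subseteq> B"
  shows "tree_mult p q = (\<Sum>x\<in>A. \<Sum>y\<in>B.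
    tree_scale (Poly_Mapping.lookup p x * Poly_Mapping.lookup q y) (graft_sum x y))"
proof -
  have "tree_mult p q = (\<Sum>x\<in>Poly_Mapping.keys p. \<Sum>y\<in>B.
    tree_scale (Poly_Mapping.lookup p x * Poly_Mapping.lookup q y) (graft_sum x y))"
    unfolding tree_mult_def
    using assms by (intro sum.cong sum.mono_neutral_left) (auto simp: in_keys_iff)
  also have "\<dots> = (\<Sum>x\<in>A. \<Sum>y\<in>B.
    tree_scale (Poly_Mapping.lookup p x * Poly_Mapping.lookup q y) (graft_sum x y))"
    using assms by (intro sum.mono_neutral_left) (auto simp: in_keys_iff)
  finally show ?thesis .
qed

lemma tree_mult_add_left: "tree_mult (p + p') q = tree_mult p q + tree_mult p' q"
proof -
  let ?A = "Poly_Mapping.keys p \<union> Poly_Mapping.keys p'"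
  have "Poly_Mapping.keys (p + p') \<subseteq> ?A"
    by (rule keys_add)
  then show ?thesis
    by (simp add: tree_mult_superset[of ?A _ "Poly_Mapping.keys q"] lookup_add distrib_right
        tree.scale_left_distrib sum.distrib)
qed

lemma tree_mult_add_right: "tree_mult p (q + q') = tree_mult p q + tree_mult p q'"
proof -
  let ?B = "Poly_Mapping.keys q \<union> Poly_Mapping.keys q'"
  have "Poly_Mapping.keys (q + q') \<subseteq> ?B"
    by (rule keys_add)
  then show ?thesis
    by (simp add: tree_mult_superset[of "Poly_Mapping.keys p" _ ?B] lookup_add distrib_left
        tree.scale_left_distrib sum.distrib)
qed

lemma keys_tree_scale: "Poly_Mapping.keys (tree_scale c p) \<subseteq> Poly_Mapping.keys p"
  by (auto simp: in_keys_iff)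

lemma tree_mult_scale_left: "tree_mult (tree_scale c p) q = tree_scale c (tree_mult p q)"
  by (simp add: tree_mult_superset[of "Poly_Mapping.keys p" _ "Poly_Mapping.keys q"]
      keys_tree_scale tree.scale_sum_right mult.assoc)

lemma tree_mult_scale_right: "tree_mult p (tree_scale c q) = tree_scale c (tree_mult p q)"
  by (simp add: tree_mult_superset[of "Poly_Mapping.keys p" _ "Poly_Mapping.keys q"]
      keys_tree_scale tree.scale_sum_right mult.left_commute)

lemma tree_mult_single:
  "tree_mult (Poly_Mapping.single x a) (Poly_Mapping.single y b) = tree_scale (a * b) (graft_sum x y)"
  by (simp add: tree_mult_superset[of "{x}" _ "{y}"])

lemma tree_mult_zero_left [simp]: "tree_mult 0 q = 0"
  by (simp add: tree_mult_def)

lemma tree_mult_zero_right [simp]: "tree_mult p 0 = 0"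
  by (simp add: tree_mult_def)

lemma tree_mult_sum_left: "tree_mult (\<Sum>i\<in>I. f i) q = (\<Sum>i\<in>I. tree_mult (f i) q)"
  by (induction I rule: infinite_finite_induct) (simp_all add: tree_mult_add_left)

lemma tree_mult_sum_right: "tree_mult p (\<Sum>i\<in>I. f i) = (\<Sum>i\<in>I. tree_mult p (f i))"
  by (induction I rule: infinite_finite_induct) (simp_all add: tree_mult_add_right)

text \<open>In \<open>(x y) z\<close> the tree \<open>z\<close> is grafted onto \<open>x\<close> or
  onto \<open>y\<close>. The latter terms make up \<open>x (y z)\<close>, so the associator keeps
  only the terms with both graftings on \<open>x\<close>; this form exposes its symmetry in
  \<open>y\<close> and \<open>z\<close>.\<close>

lemma graft_sum_assoc:
  fixes x y z :: "'a rel"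
  defines "good \<equiv> finite x \<and> finite y \<and> finite z \<and>
    Field x \<inter> Field y = {} \<and> Field x \<inter> Field z = {} \<and> Field y \<inter> Field z = {}"
  shows "tree_mult (graft_sum x y) (Poly_Mapping.single z 1)
      - tree_mult (Poly_Mapping.single x 1) (graft_sum y z)
    = (if good then \<Sum>v\<in>Field x. \<Sum>u\<in>Field x. Poly_Mapping.single (graft (graft x v y) u z) 1
       else (0 :: 'a rel \<Rightarrow>\<^sub>0 'k::field))"
proof (cases good)
  case True
  then have [simp]: "finite (Field x)" "finite (Field y)" "finite (Field z)"
    by (simp_all add: good_def finite_Field)
  have "tree_mult (graft_sum x y) (Poly_Mapping.single z 1) =
      (\<Sum>v\<in>Field x. graft_sum (graft x v y) z :: 'a rel \<Rightarrow>\<^sub>0 'k)"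
    using True by (simp add: good_def graft_sum_def[of x y] tree_mult_sum_left tree_mult_single)
  also have "\<dots> = (\<Sum>v\<in>Field x. \<Sum>u\<in>Field x \<union> Field y.
      Poly_Mapping.single (graft (graft x v y) u z) 1)"
    using True by (intro sum.cong) (auto simp: good_def graft_sum_def Field_graft finite_graft_iff)
  also have "\<dots> = (\<Sum>v\<in>Field x. \<Sum>u\<in>Field x. Poly_Mapping.single (graft (graft x v y) u z) 1)
      + (\<Sum>v\<in>Field x. \<Sum>u\<in>Field y. Poly_Mapping.single (graft (graft x v y) u z) 1)"
    using True by (simp add: sum.union_disjoint sum.distrib good_def)
  \<comment> \<open>The terms with \<open>z\<close> grafted onto a vertex of \<open>y\<close> are
    regrouped by \<open>graft_assoc\<close>.\<close>
  also have "(\<Sum>v\<in>Field x. \<Sum>u\<in>Field y. Poly_Mapping.single (graft (graft x v y) u z) 1)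
      = (\<Sum>u\<in>Field y. \<Sum>v\<in>Field x. Poly_Mapping.single (graft x v (graft y u z)) (1 :: 'k))"
    using True by (subst sum.swap) (auto simp: good_def graft_assoc intro!: sum.cong)
  also have "\<dots> = (\<Sum>u\<in>Field y. graft_sum x (graft y u z))"
    using True by (intro sum.cong) (auto simp: good_def graft_sum_def Field_graft finite_graft_iff)
  also have "\<dots> = tree_mult (Poly_Mapping.single x 1) (graft_sum y z)"
    using True by (simp add: good_def graft_sum_def[of y z] tree_mult_sum_right tree_mult_single)
  finally show ?thesis
    using True by simp
next
  case False
  \<comment> \<open>A graft has the union of both fields, so whatever violates \<open>good\<close>
    either makes the inner product 0 or reappears in the outer one.\<close>
  have "graft_sum (graft x v y) z = (0 :: 'a rel \<Rightarrow>\<^sub>0 'k)"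
    if "finite x \<and> finite y \<and> Field x \<inter> Field y = {}" for v
    using False that by (auto simp: good_def graft_sum_def Field_graft finite_graft_iff Int_Un_distrib2)
  moreover have "graft_sum x (graft y u z) = (0 :: 'a rel \<Rightarrow>\<^sub>0 'k)"
    if "finite y \<and> finite z \<and> Field y \<inter> Field z = {}" for u
    using False that by (auto simp: good_def graft_sum_def Field_graft finite_graft_iff Int_Un_distrib)
  ultimately have "tree_mult (graft_sum x y) (Poly_Mapping.single z 1) = (0 :: 'a rel \<Rightarrow>\<^sub>0 'k)"
    "tree_mult (Poly_Mapping.single x 1) (graft_sum y z) = (0 :: 'a rel \<Rightarrow>\<^sub>0 'k)"
    by (simp_all add: graft_sum_def[of x y] graft_sum_def[of y z] tree_mult_sum_left
        tree_mult_sum_right tree_mult_single)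
  then show ?thesis
    using False by simp
qed

lemma tree_mult_assoc_single:
  fixes x y z :: "'a rel" and a b c :: "'k::field"
  defines "X \<equiv> Poly_Mapping.single x a" and "Y \<equiv> Poly_Mapping.single y b"
    and "Z \<equiv> Poly_Mapping.single z c"
  shows "tree_mult (tree_mult X Y) Z - tree_mult X (tree_mult Y Z) =
    tree_mult (tree_mult X Z) Y - tree_mult X (tree_mult Z Y)"
proof -
  have *: "tree_mult (tree_mult (Poly_Mapping.single x a) (Poly_Mapping.single y b))
      (Poly_Mapping.single z c)
      - tree_mult (Poly_Mapping.single x a)
          (tree_mult (Poly_Mapping.single y b) (Poly_Mapping.single z c))
      = tree_scale (a * b * c) (tree_mult (graft_sum x y) (Poly_Mapping.single z 1)
          - tree_mult (Poly_Mapping.single x 1) (graft_sum y z))"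
    for y z and b c :: 'k
  proof -
    have "Poly_Mapping.single z c = tree_scale c (Poly_Mapping.single z 1)"
      "Poly_Mapping.single x a = tree_scale a (Poly_Mapping.single x 1)"
      by (simp_all add: tree_scale_single)
    then show ?thesis
      by (simp add: tree_mult_single tree_mult_scale_left tree_mult_scale_right
          tree.scale_right_diff_distrib mult.commute mult.left_commute)
  qed
  \<comment> \<open>Exchanging the two summations over \<open>Field x\<close> and applying
    \<open>graft_commute\<close> swaps \<open>y\<close> and \<open>z\<close>.\<close>
  have "tree_mult (graft_sum x y) (Poly_Mapping.single z 1)
      - tree_mult (Poly_Mapping.single x 1) (graft_sum y z) =
    tree_mult (graft_sum x z) (Poly_Mapping.single y 1)
      - tree_mult (Poly_Mapping.single x 1) (graft_sum z y :: 'a rel \<Rightarrow>\<^sub>0 'k)"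
    unfolding graft_sum_assoc
    by (subst sum.swap) (auto simp: graft_commute intro!: sum.cong)
  then show ?thesis
    unfolding X_def Y_def Z_def * by (simp add: mult.assoc mult.commute)
qed

text \<open>Reduces an identity that is additive in each argument to scalar multiples of basis
  elements.\<close>

lemma single_add_induct [case_names single add]:
  assumes "\<And>x a. P (Poly_Mapping.single x a)" and "\<And>p q. P p \<Longrightarrow> P q \<Longrightarrow> P (p + q)"
  shows "P (p :: 'b \<Rightarrow>\<^sub>0 'k::comm_monoid_add)"
proof -
  have "P (\<Sum>x\<in>A. Poly_Mapping.single x (Poly_Mapping.lookup p x))" for A
  proof (induction A rule: infinite_finite_induct)
    case (insert x A)
    then show ?case by (simp add: assms)
  qed (use assms(1)[of undefined 0] in simp_all)
  moreover have "p = (\<Sum>x\<in>Poly_Mapping.keys p. Poly_Mapping.single x (Poly_Mapping.lookup p x))"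
    by (rule poly_mapping_eqI) (simp add: lookup_sum lookup_single when_def in_keys_iff)
  ultimately show ?thesis
    by metis
qed

lemma tree_mult_pre_lie:
  "tree_mult (tree_mult p q) r - tree_mult p (tree_mult q r) =
    tree_mult (tree_mult p r) q - tree_mult p (tree_mult r q)"
proof (induction p rule: single_add_induct)
  case (single x a)
  show ?case
  proof (induction q rule: single_add_induct)
    case (single y b)
    show ?case
    proof (induction r rule: single_add_induct)
      case (single z c)
      show ?case by (rule tree_mult_assoc_single)
    next
      case (add r r')
      then show ?case
        by (simp add: tree_mult_add_left tree_mult_add_right algebra_simps)
    qed
  next
    case (add r r')
    then show ?case
      by (simp add: tree_mult_add_left tree_mult_add_right algebra_simps)
  qed
next
  case (add r r')
  then show ?case
    by (simp add: tree_mult_add_left tree_mult_add_right algebra_simps)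
qed

global_interpretation tree: pre_lie_algebra tree_scale tree_mult
  by standard (simp_all add: tree_mult_add_left tree_mult_add_right tree_mult_scale_left
      tree_mult_scale_right tree_mult_pre_lie)

section \<open>Leading trees of monomials\<close>

primrec root :: "'a magma \<Rightarrow> 'a" where
  "root (Gen a) = a"
| "root (Mul s t) = root s"

primrec leading_tree :: "'a magma \<Rightarrow> 'a rel" where
  "leading_tree (Gen a) = {(a, a)}"
| "leading_tree (Mul s t) = graft (leading_tree s) (root s) (leading_tree t)"

text \<open>Records the features of a rooted tree on which the depth comparison and the recovery of
  branches rest: every vertex is its own ancestor, \<open>r\<close> has no other ancestor, and
  \<open>r\<close> lies above everything.\<close>

definition rooted_at :: "'a \<Rightarrow> 'a rel \<Rightarrow> bool" where
  "rooted_at r x \<longleftrightarrow> finite x \<and> Id_on (Field x) \<subseteq> x \<and> anc x r = {r} \<and> (\<forall>u\<in>Field x. r \<in> anc x u)"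

lemma finite_anc: "finite x \<Longrightarrow> finite (anc x v)"
  by (rule finite_subset[OF anc_subset_Field finite_Field])

lemma anc_self: "rooted_at r x \<Longrightarrow> u \<in> Field x \<Longrightarrow> u \<in> anc x u"
  by (auto simp: rooted_at_def anc_def)

lemma root_in_Field: "rooted_at r x \<Longrightarrow> r \<in> Field x"
  by (auto simp: rooted_at_def anc_def Field_def)

lemma rooted_at_graft:
  assumes "rooted_at r x" "rooted_at s y" "Field x \<inter> Field y = {}" "v \<in> Field x"
  shows "rooted_at r (graft x v y)"
  using assms root_in_Field[OF assms(1)]
  unfolding rooted_at_def by (auto simp: Field_graft anc_graft_left anc_graft_right finite_graft_iff)
    (auto simp: graft_def)

section \<open>Total depth of grafts\<close>

lemma card_graft:
  assumes "finite x" "finite y" "Field x \<inter> Field y = {}"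
  shows "card (graft x v y) = card x + card y + card (anc x v) * card (Field y)"
proof -
  have "finite (anc x v)" "finite (Field y)"
    using assms by (simp_all add: finite_anc finite_Field)
  moreover have "x \<inter> y = {}" "(x \<union> y) \<inter> anc x v \<times> Field y = {}"
    using assms by (auto simp: anc_def Field_def)
  ultimately show ?thesis
    using assms by (simp add: graft_def card_Un_disjoint)
qed

lemma card_graft_root:
  assumes "rooted_at r x" "rooted_at s y" "Field x \<inter> Field y = {}"
  shows "card (graft x r y) = card x + card y + card (Field y)"
  using assms by (simp add: card_graft rooted_at_def)

text \<open>A vertex \<open>v\<close> other than the root has at least the two ancestors
  \<open>r\<close> and \<open>v\<close>, and each of them is paired with all of the nonempty
  \<open>Field y\<close>.\<close>

lemma card_graft_nonroot:
  assumes "rooted_at r x" "rooted_at s y" "Field x \<inter> Field y = {}" "v \<in> Field x" "v \<noteq> r"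
  shows "card x + card y + card (Field y) < card (graft x v y)"
proof -
  have "finite (anc x v)"
    using assms by (simp add: rooted_at_def finite_anc)
  moreover have "{r, v} \<subseteq> anc x v"
    using assms anc_self[of r x v] by (auto simp: rooted_at_def)
  ultimately have "card (anc x v) \<ge> 2"
    using assms(5) card_mono[of "anc x v" "{r, v}"] by simp
  moreover have "card (Field y) > 0"
    using assms root_in_Field[of s y] by (auto simp: card_gt_0_iff rooted_at_def finite_Field)
  ultimately have "card (Field y) < card (anc x v) * card (Field y)"
    by simp
  then show ?thesis
    using assms by (simp add: card_graft rooted_at_def)
qed

text \<open>Multilinearity in recursive form, so that inductions pass to the factors.\<close>

primrec distinct_gens :: "'a magma \<Rightarrow> bool" where
  "distinct_gens (Gen a) \<longleftrightarrow> True"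
| "distinct_gens (Mul s t) \<longleftrightarrow> distinct_gens s \<and> distinct_gens t \<and>
     set_mset (generators s) \<inter> set_mset (generators t) = {}"

lemma generators_distinct: "distinct_gens m \<Longrightarrow> generators m = mset_set (set_mset (generators m))"
proof (induction m)
  case (Mul s t)
  then show ?case by (simp add: mset_set_Union)
qed simp

lemma distinct_gensI:
  assumes "\<And>a. count (generators m) a \<le> 1"
  shows "distinct_gens m"
  using assms
proof (induction m)
  case (Mul s t)
  have le: "count (generators s) a + count (generators t) a \<le> 1" for a
    using Mul.prems[of a] by simp
  have "distinct_gens s" "distinct_gens t"
    using add_leD1[OF le] add_leD2[OF le] by (simp_all add: Mul.IH)
  moreover have "\<not> (a \<in># generators s \<and> a \<in># generators t)" for a
    using le[of a] count_greater_zero_iff[of "generators s" a]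
      count_greater_zero_iff[of "generators t" a] by linarith
  ultimately show ?case by auto
qed simp

lemma distinct_gens_mset_set: "generators m = mset_set A \<Longrightarrow> distinct_gens m"
  by (rule distinct_gensI) (simp add: count_mset_set')

section \<open>Expansion of multilinear monomials into trees\<close>

lemma Field_leading_tree: "Field (leading_tree m) = set_mset (generators m)"
  by (induction m) (auto simp: Field_graft)

lemma rooted_at_leading_tree: "distinct_gens m \<Longrightarrow> rooted_at (root m) (leading_tree m)"
proof (induction m)
  case (Gen a)
  show ?case by (auto simp: rooted_at_def anc_def)
next
  case (Mul s t)
  then have "rooted_at (root s) (leading_tree s)" "rooted_at (root t) (leading_tree t)"
    by simp_all
  then show ?case
    using Mul.prems by (auto simp: Field_leading_tree
        intro!: rooted_at_graft root_in_Field)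
qed

text \<open>The image of a monomial under the homomorphism from the free pre-Lie algebra that sends
  the generator \<open>a\<close> to the one-vertex tree \<open>{(a, a)}\<close>.\<close>

abbreviation expansion :: "'a magma \<Rightarrow> ('a rel \<Rightarrow>\<^sub>0 'k::field)" where
  "expansion \<equiv> tree.eval_magma (\<lambda>a. Poly_Mapping.single {(a, a)} 1)"

lemma keys_graft_sum:
  "Poly_Mapping.keys (graft_sum x y :: 'a rel \<Rightarrow>\<^sub>0 'k::field) \<subseteq> (\<lambda>v. graft x v y) ` Field x"
proof -
  have "Poly_Mapping.keys (\<Sum>v\<in>Field x. Poly_Mapping.single (graft x v y) (1 :: 'k)) \<subseteq>
      (\<Union>v\<in>Field x. Poly_Mapping.keys (Poly_Mapping.single (graft x v y) (1 :: 'k)))"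
    by (rule keys_sum)
  then show ?thesis
    by (auto simp: graft_sum_def)
qed

lemma keys_tree_mult:
  fixes p q :: "'a rel \<Rightarrow>\<^sub>0 'k::field"
  assumes "z \<in> Poly_Mapping.keys (tree_mult p q)"
  obtains x y v where "x \<in> Poly_Mapping.keys p" "y \<in> Poly_Mapping.keys q" "v \<in> Field x"
    "z = graft x v y"
proof -
  have "Poly_Mapping.keys (tree_mult p q) \<subseteq> (\<Union>x\<in>Poly_Mapping.keys p. \<Union>y\<in>Poly_Mapping.keys q.
      (\<lambda>v. graft x v y) ` Field x)"
    unfolding tree_mult_def using keys_tree_scale keys_graft_sum
    by (intro order_trans[OF keys_sum] UN_mono order_refl) blast
  then show ?thesis
    using assms that by blast
qed

text \<open>Depth is minimal in a product exactly when both factors contribute their leading trees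
  and the grafting is at the root. The claims are proved jointly, since the coefficient is computed
  from the list of all terms.\<close>

lemma expansion_leading_tree:
  assumes "distinct_gens m"
  shows "x \<in> Poly_Mapping.keys (expansion m :: 'a rel \<Rightarrow>\<^sub>0 'k::field) \<Longrightarrow>
      Field x = set_mset (generators m) \<and> rooted_at (root m) x \<and>
      (x = leading_tree m \<or> card (leading_tree m) < card x)"
    and "Poly_Mapping.lookup (expansion m :: 'a rel \<Rightarrow>\<^sub>0 'k) (leading_tree m) = 1"
proof -
  have "(\<forall>x \<in> Poly_Mapping.keys (expansion m :: 'a rel \<Rightarrow>\<^sub>0 'k).
      Field x = set_mset (generators m) \<and> rooted_at (root m) x \<and>
      (x = leading_tree m \<or> card (leading_tree m) < card x)) \<and>
    Poly_Mapping.lookup (expansion m :: 'a rel \<Rightarrow>\<^sub>0 'k) (leading_tree m) = 1"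
    using assms
  proof (induction m)
    case (Gen a)
    then show ?case by (auto simp: rooted_at_def anc_def)
  next
    case (Mul s t)
    let ?s = "leading_tree s" and ?t = "leading_tree t"
    let ?es = "expansion s :: 'a rel \<Rightarrow>\<^sub>0 'k" and ?et = "expansion t :: 'a rel \<Rightarrow>\<^sub>0 'k"
    let ?F = "set_mset (generators s)" and ?G = "set_mset (generators t)"
    have dist: "distinct_gens s" "distinct_gens t" and FG: "?F \<inter> ?G = {}"
      using Mul.prems by auto
    have s: "Field x = ?F \<and> rooted_at (root s) x \<and> (x = ?s \<or> card ?s < card x)"
      if "x \<in> Poly_Mapping.keys ?es" for x
      using Mul.IH(1) dist that by blast
    have t: "Field x = ?G \<and> rooted_at (root t) x \<and> (x = ?t \<or> card ?t < card x)"
      if "x \<in> Poly_Mapping.keys ?et" for x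
      using Mul.IH(2) dist that by blast
    have 1: "Poly_Mapping.lookup ?es ?s = 1" "Poly_Mapping.lookup ?et ?t = 1"
      using Mul.IH dist by auto
    then have keys: "?s \<in> Poly_Mapping.keys ?es" "?t \<in> Poly_Mapping.keys ?et"
      by (simp_all add: in_keys_iff)
    have card_lead: "card (graft ?s (root s) ?t) = card ?s + card ?t + card ?G"
      using s[OF keys(1)] t[OF keys(2)] FG card_graft_root[of "root s" ?s "root t" ?t] by simp
    \<comment> \<open>Equality of trees alone would not exclude that several triples
      \<open>(x, v, y)\<close> give the leading tree; here the triple itself is determined.\<close>
    have main: "graft x v y = graft ?s (root s) ?t \<and> x = ?s \<and> y = ?t \<and> v = root s \<or>
        card (graft ?s (root s) ?t) < card (graft x v y)"
      if "x \<in> Poly_Mapping.keys ?es" "y \<in> Poly_Mapping.keys ?et" "v \<in> Field x" for x y v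
    proof (cases "v = root s")
      case True
      then show ?thesis
        using s[OF that(1)] t[OF that(2)] card_graft_root[of "root s" x "root t" y] FG card_lead by auto
    next
      case False
      then show ?thesis
        using s[OF that(1)] t[OF that(2)] card_graft_nonroot[of "root s" x "root t" y v] FG that
          card_lead by auto
    qed
    have "Field z = set_mset (generators (Mul s t)) \<and> rooted_at (root (Mul s t)) z \<and>
      (z = leading_tree (Mul s t) \<or> card (leading_tree (Mul s t)) < card z)"
      if "z \<in> Poly_Mapping.keys (expansion (Mul s t) :: 'a rel \<Rightarrow>\<^sub>0 'k)" for z
    proof -
      have "z \<in> Poly_Mapping.keys (tree_mult ?es ?et)"
        using that by simp
      then obtain x y v where z: "x \<in> Poly_Mapping.keys ?es" "y \<in> Poly_Mapping.keys ?et"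
        "v \<in> Field x" "z = graft x v y"
        by (rule keys_tree_mult)
      show ?thesis
        using s[OF z(1)] t[OF z(2)] FG main[OF z(1-3)] z(3,4)
        by (auto simp: Field_graft intro!: rooted_at_graft)
    qed
    moreover have "Poly_Mapping.lookup (tree_mult ?es ?et) (graft ?s (root s) ?t) = 1"
    proof -
      \<comment> \<open>By \<open>main\<close>, only the pair of leading trees contributes, and only
        through the summand with \<open>v\<close> the root of \<open>s\<close>.\<close>
      have coeff: "Poly_Mapping.lookup (graft_sum x y :: 'a rel \<Rightarrow>\<^sub>0 'k) (graft ?s (root s) ?t) =
          (if x = ?s then if y = ?t then 1 else 0 else 0)"
        if xy: "x \<in> Poly_Mapping.keys ?es" "y \<in> Poly_Mapping.keys ?et" for x y
      proof -
        have "finite x" "finite y" "Field x \<inter> Field y = {}"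
          using s[OF xy(1)] t[OF xy(2)] FG by (auto simp: rooted_at_def)
        then have "Poly_Mapping.lookup (graft_sum x y :: 'a rel \<Rightarrow>\<^sub>0 'k) (graft ?s (root s) ?t) =
            (\<Sum>v\<in>Field x. if graft x v y = graft ?s (root s) ?t then 1 else 0)"
          by (simp add: graft_sum_def lookup_sum lookup_single when_def)
        also have "\<dots> = (\<Sum>v\<in>Field x. if v = root s then if x = ?s \<and> y = ?t then 1 else 0 else 0)"
        proof (intro sum.cong refl)
          fix v assume "v \<in> Field x"
          from main[OF xy this]
          show "(if graft x v y = graft ?s (root s) ?t then 1 else 0) =
              (if v = root s then if x = ?s \<and> y = ?t then 1 else 0 else (0 :: 'k))"
            by (elim disjE) (simp, metis less_irrefl)
        qed
        also have "\<dots> = (if x = ?s then if y = ?t then 1 else 0 else 0)"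
          using root_in_Field[of "root s" x] s[OF xy(1)] \<open>finite x\<close> by (simp add: finite_Field)
        finally show ?thesis .
      qed
      have "Poly_Mapping.lookup (tree_mult ?es ?et) (graft ?s (root s) ?t) =
          (\<Sum>x\<in>Poly_Mapping.keys ?es. \<Sum>y\<in>Poly_Mapping.keys ?et.
            if x = ?s then if y = ?t then 1 else 0 else 0)"
        unfolding tree_mult_def[of ?es ?et] lookup_sum using 1
        by (intro sum.cong refl) (simp add: coeff)
      also have "\<dots> = 1"
        using keys by (subst sum.swap) simp
      finally show ?thesis .
    qed
    ultimately show ?case by simp
  qed
  then show "x \<in> Poly_Mapping.keys (expansion m :: 'a rel \<Rightarrow>\<^sub>0 'k::field) \<Longrightarrow>
      Field x = set_mset (generators m) \<and> rooted_at (root m) x \<and>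
      (x = leading_tree m \<or> card (leading_tree m) < card x)"
    and "Poly_Mapping.lookup (expansion m :: 'a rel \<Rightarrow>\<^sub>0 'k) (leading_tree m) = 1"
    by blast+
qed

section \<open>Splitting off the branch at the root that contains a given vertex\<close>

lemma graft_root: "rooted_at r x \<Longrightarrow> graft x r y = x \<union> y \<union> {r} \<times> Field y"
  by (simp add: graft_def rooted_at_def)

text \<open>An ancestor of \<open>b\<close> other than \<open>r\<close> lies in \<open>y\<close>,
  and so do its descendants; conversely the root \<open>s\<close> of \<open>y\<close> is such an
  ancestor, shared by all of \<open>Field y\<close>. The right-hand side mentions only the graft,
  \<open>r\<close> and \<open>b\<close>.\<close>

lemma Field_branch:
  assumes "rooted_at r x" "rooted_at s y" "Field x \<inter> Field y = {}" "b \<in> Field y"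
  shows "Field y = {w. \<exists>c. c \<noteq> r \<and> (c, b) \<in> graft x r y \<and> (c, w) \<in> graft x r y}" (is "_ = ?D")
proof
  have "(s, w) \<in> y" if "w \<in> Field y" for w
    using assms(2) that by (auto simp: rooted_at_def anc_def)
  moreover have "s \<noteq> r"
    using assms root_in_Field by fastforce
  ultimately show "Field y \<subseteq> ?D"
    using assms(4) by (auto simp: graft_root[OF assms(1)])
next
  show "?D \<subseteq> Field y"
  proof clarify
    fix w c
    assume c: "c \<noteq> r" "(c, b) \<in> graft x r y" "(c, w) \<in> graft x r y"
    then have "(c, b) \<in> y"
      using assms(3,4) by (auto simp: graft_root[OF assms(1)] Field_def)
    then have "c \<in> Field y"
      by (auto simp: Field_def)
    then show "w \<in> Field y"
      using c assms(3) by (auto simp: graft_root[OF assms(1)] Field_def)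
  qed
qed

lemma graft_restrict:
  assumes "rooted_at r x" "Field x \<inter> Field y = {}"
  shows "x = graft x r y \<inter> (Field (graft x r y) - Field y) \<times> (Field (graft x r y) - Field y)"
    and "y = graft x r y \<inter> Field y \<times> Field y"
proof -
  have "x \<subseteq> Field x \<times> Field x" "y \<subseteq> Field y \<times> Field y"
    by (auto simp: Field_def)
  then show "x = graft x r y \<inter> (Field (graft x r y) - Field y) \<times> (Field (graft x r y) - Field y)"
    and "y = graft x r y \<inter> Field y \<times> Field y"
    using assms(2) root_in_Field[OF assms(1)] unfolding Field_graft
    by (auto simp: graft_root[OF assms(1)])
qed

text \<open>A graft forgets which branch was attached last; the label \<open>b\<close> singles it
  out, and both parts are then restrictions of the graft.\<close>

lemma graft_inject:
  assumes "rooted_at r x" "rooted_at s y" "Field x \<inter> Field y = {}" "b \<in> Field y"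
    and "rooted_at r x'" "rooted_at s' y'" "Field x' \<inter> Field y' = {}" "b \<in> Field y'"
    and "graft x r y = graft x' r y'"
  shows "x = x' \<and> y = y'"
proof -
  have "Field y = Field y'"
    using Field_branch[OF assms(1-4)] Field_branch[OF assms(5-8)] assms(9) by simp
  then show ?thesis
    using graft_restrict[OF assms(1,3)] graft_restrict[OF assms(5,7)] assms(9) by metis
qed

lemma rooted_at_unique: "rooted_at r x \<Longrightarrow> rooted_at r' x \<Longrightarrow> r = r'"
  using root_in_Field[of r' x] by (auto simp: rooted_at_def)

section \<open>Leading trees of pointed Lyndon trees\<close>

primrec tree_monomial :: "bctree \<Rightarrow> nat magma" where
  "tree_monomial (Leaf a) = Gen a"
| "tree_monomial (Node l u r) =
     (if u then Mul (tree_monomial l) (tree_monomial r) else Mul (tree_monomial r) (tree_monomial l))"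

lemma Theta_eq_free_monomial: "Theta T = free_monomial (tree_monomial T)"
  by (induction T) auto

lemma generators_tree_monomial [simp]: "generators (tree_monomial T) = leaves T"
  by (induction T) auto

lemma leaves_nonempty [simp]: "leaves T \<noteq> {#}"
  by (induction T) auto

lemma min_leaf_in: "\<nu> T \<in># leaves T"
  unfolding min_leaf_def by (rule Min_in) auto

lemma min_leaf_le: "a \<in># leaves T \<Longrightarrow> \<nu> T \<le> a"
  unfolding min_leaf_def by (rule Min_le) auto

lemma min_leaf_Leaf [simp]: "\<nu> (Leaf a) = a"
  by (simp add: min_leaf_def)

lemma min_leaf_Node [simp]: "\<nu> (Node l u r) = min (\<nu> l) (\<nu> r)"
  unfolding min_leaf_def by (simp add: Min_Un)

section \<open>Structure of pointed Lyndon trees\<close>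

lemma pointed_Lyndon_Leaf [simp]: "pointed_Lyndon (Leaf a)"
  by (simp add: pointed_Lyndon_def normalized_def internal_vertices_def)

lemma internal_vertices_Node:
  "internal_vertices (Node l u r) =
    insert (Node l u r) (internal_vertices l \<union> internal_vertices r)"
  by (auto simp: internal_vertices_def)

text \<open>At a root of color 0 both color conditions are trivial; at a root of color 1 they force
  color 1 and the Lyndon inequality for an internal left child.\<close>

lemma pointed_Lyndon_Node:
  "pointed_Lyndon (Node l u r) \<longleftrightarrow> pointed_Lyndon l \<and> pointed_Lyndon r \<and> \<nu> l \<le> \<nu> r \<and>
    (is_internal l \<and> u \<longrightarrow> color l \<and> \<nu> r < \<nu> (right l))"
  unfolding pointed_Lyndon_def normalized_def internal_vertices_Node Lyndon_def
  by (auto simp: min_def)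

text \<open>Below a vertex of color 1 the whole left spine has color 1, so the root of the monomial
  is the leftmost leaf, which is the minimum. The minima of the right subtrees increase down the
  spine.\<close>

lemma pointed_Lyndon_color_1:
  "pointed_Lyndon (Node l True r) \<Longrightarrow> root (tree_monomial l) = \<nu> l \<and>
    (\<forall>b\<in>#leaves l. b = \<nu> l \<or> \<nu> r < b)"
proof (induction l arbitrary: r)
  case (Node l' u' r')
  then have u': "u'" and *: "pointed_Lyndon (Node l' True r')" "\<nu> r < \<nu> r'" "\<nu> l' \<le> \<nu> r'"
    by (auto simp: pointed_Lyndon_Node)
  then show ?case
    using Node.IH(1)[OF *(1)] min_leaf_le[of _ r'] by (auto simp: min_def) fastforce+
qed simp

text \<open>For color 0 the root of the monomial lies in \<open>r\<close>, whereas the smallest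
  label lies in \<open>l\<close>. Thus the color can be read off the leading tree.\<close>

lemma pointed_Lyndon_color_iff:
  assumes "pointed_Lyndon (Node l u r)" "distinct_gens (tree_monomial (Node l u r))"
  shows "u \<longleftrightarrow> root (tree_monomial (Node l u r)) = \<nu> (Node l u r)"
proof (cases u)
  case True
  then show ?thesis
    using assms pointed_Lyndon_color_1[of l r] by (auto simp: pointed_Lyndon_Node)
next
  case False
  have "root m \<in># generators m" for m :: "nat magma"
    by (induction m) auto
  from this[of "tree_monomial r"] show ?thesis
    using False assms min_leaf_in[of l] by (auto simp: pointed_Lyndon_Node min_def)
qed

text \<open>All labels of \<open>l\<close> except its minimum exceed \<open>\<nu> r\<close>. Hence
  the second smallest label marks the branch to be split off at a vertex of color 1.\<close>

lemma pointed_Lyndon_second_min: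
  assumes "pointed_Lyndon (Node l True r)" "set_mset (leaves l) \<inter> set_mset (leaves r) = {}"
  shows "\<nu> r = Min (set_mset (leaves l + leaves r) - {\<nu> l})"
proof (rule Min_eqI[symmetric])
  show "\<nu> r \<in> set_mset (leaves l + leaves r) - {\<nu> l}"
    using assms(2) min_leaf_in[of l] min_leaf_in[of r] by auto
next
  fix b
  assume "b \<in> set_mset (leaves l + leaves r) - {\<nu> l}"
  then show "\<nu> r \<le> b"
    using pointed_Lyndon_color_1[OF assms(1)] min_leaf_le[of b r] by auto
qed simp

text \<open>The leading tree determines the labels, its root and hence the color. A label computable
  from these data then marks the last branch, and \<open>graft_inject\<close> yields the leading
  trees of both subtrees.\<close>

lemma leading_tree_inject:
  assumes "pointed_Lyndon T" "distinct_gens (tree_monomial T)"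
    and "pointed_Lyndon T'" "distinct_gens (tree_monomial T')"
    and "leading_tree (tree_monomial T) = leading_tree (tree_monomial T')"
  shows "T = T'"
  using assms
proof (induction T arbitrary: T')
  case (Leaf a)
  have "set_mset (leaves T') = {a}"
    using Field_leading_tree[of "tree_monomial T'"] Leaf.prems(5)[symmetric] by simp
  then have "leaves T' = mset_set {a}"
    using generators_distinct[OF Leaf.prems(4)] by (metis generators_tree_monomial)
  then have eq: "leaves T' = {#a#}"
    by simp
  then show ?case
  proof (cases T')
    case (Node l u r)
    then show ?thesis
      using eq by (auto simp: union_is_single)
  qed simp
next
  case (Node l u r)
  let ?T = "Node l u r"
  let ?f = "\<lambda>T. leading_tree (tree_monomial T)"
  have leaves: "leaves ?T = leaves T'"
    using Node.prems(5) Field_leading_tree[of "tree_monomial ?T"]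
      Field_leading_tree[of "tree_monomial T'"]
      generators_distinct[OF Node.prems(2)] generators_distinct[OF Node.prems(4)]
    by (metis generators_tree_monomial)
  obtain l' u' r' where T': "T' = Node l' u' r'"
  proof (cases T')
    case (Leaf a)
    then show ?thesis
      using leaves by (auto simp: union_is_single)
  qed
  have min_eq: "\<nu> ?T = \<nu> T'"
    using leaves by (simp add: min_leaf_def)
  have root_eq: "root (tree_monomial ?T) = root (tree_monomial T')"
    using rooted_at_leading_tree[OF Node.prems(2)] rooted_at_leading_tree[OF Node.prems(4)]
      Node.prems(5) rooted_at_unique by metis
  have u: "u = u'"
    using pointed_Lyndon_color_iff[OF Node.prems(1,2)] pointed_Lyndon_color_iff[of l' u' r']
      Node.prems(3,4) root_eq min_eq unfolding T' by simp
  have sub: "pointed_Lyndon l" "pointed_Lyndon r" "pointed_Lyndon l'" "pointed_Lyndon r'"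
    "distinct_gens (tree_monomial l)" "distinct_gens (tree_monomial r)"
    "distinct_gens (tree_monomial l')" "distinct_gens (tree_monomial r')"
    "set_mset (leaves l) \<inter> set_mset (leaves r) = {}"
    "set_mset (leaves l') \<inter> set_mset (leaves r') = {}"
    "\<nu> l \<le> \<nu> r" "\<nu> l' \<le> \<nu> r'"
    using Node.prems(1-4) by (auto simp: T' pointed_Lyndon_Node split: if_splits)
  then have nu_l: "\<nu> l = \<nu> l'"
    using min_eq by (simp add: T' min_def)
  note rooted = sub(5-8)[THEN rooted_at_leading_tree]
  have disj: "Field (?f l) \<inter> Field (?f r) = {}" "Field (?f r) \<inter> Field (?f l) = {}"
    "Field (?f l') \<inter> Field (?f r') = {}" "Field (?f r') \<inter> Field (?f l') = {}"
    using sub(9,10) by (auto simp: Field_leading_tree)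
  have "?f l = ?f l' \<and> ?f r = ?f r'"
  proof (cases u)
    case True
    \<comment> \<open>For color 1 the marking label is the second smallest one, and the branch split
      off is that of \<open>r\<close>.\<close>
    have "\<nu> r = \<nu> r'"
      using pointed_Lyndon_second_min[of l r] pointed_Lyndon_second_min[of l' r'] leaves nu_l True u
        Node.prems(1,3) sub(9,10) by (simp add: T' del: set_mset_union)
    then have "\<nu> r \<in> Field (?f r)" "\<nu> r \<in> Field (?f r')"
      using min_leaf_in[of r] min_leaf_in[of r'] by (simp_all add: Field_leading_tree)
    moreover have "root (tree_monomial l) = root (tree_monomial l')"
      "graft (?f l) (root (tree_monomial l)) (?f r) = graft (?f l') (root (tree_monomial l)) (?f r')"
      using root_eq Node.prems(5) True u by (simp_all add: T')
    ultimately show ?thesis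
      using graft_inject rooted disj by metis
  next
    case False
    \<comment> \<open>For color 0 the factors are reversed: the branch split off is that of
      \<open>l\<close>, marked by the smallest label.\<close>
    have "\<nu> l \<in> Field (?f l)" "\<nu> l \<in> Field (?f l')"
      using min_leaf_in[of l] min_leaf_in[of l'] nu_l by (simp_all add: Field_leading_tree)
    moreover have "root (tree_monomial r) = root (tree_monomial r')"
      "graft (?f r) (root (tree_monomial r)) (?f l) = graft (?f r') (root (tree_monomial r)) (?f l')"
      using root_eq Node.prems(5) False u by (simp_all add: T')
    ultimately show ?thesis
      using graft_inject rooted disj by metis
  qed
  then show ?case
    using Node.IH(1)[of l'] Node.IH(2)[of r'] sub u unfolding T' by blast
qed

section \<open>Rewriting monomials to pointed Lyndon form\<close>

text \<open>The relation \<open>(x y) z = (x z) y\<close> defines non-associative permutative (NAP) algebras.\<close>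

inductive nap :: "'a magma \<Rightarrow> 'a magma \<Rightarrow> bool" where
  refl: "nap m m"
| trans: "nap m m' \<Longrightarrow> nap m' m'' \<Longrightarrow> nap m m''"
| swap: "nap (Mul (Mul s t) v) (Mul (Mul s v) t)"
| left: "nap s s' \<Longrightarrow> nap (Mul s t) (Mul s' t)"
| right: "nap t t' \<Longrightarrow> nap (Mul s t) (Mul s t')"

text \<open>For distinct generators this is the total depth of the leading tree with the root at
  depth 0, that is, its number of ancestor pairs with different entries.\<close>

primrec weight :: "'a magma \<Rightarrow> nat" where
  "weight (Gen a) = 0"
| "weight (Mul s t) = weight s + weight t + size (generators t)"

lemma generators_nonempty [simp]: "generators m \<noteq> {#}"
  by (induction m) auto

lemma weight_le: "weight m \<le> (size (generators m))\<^sup>2"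
proof (induction m)
  case (Mul s t)
  let ?s = "size (generators s)" and ?t = "size (generators t)"
  have "1 \<le> ?s"
    by (simp add: Suc_le_eq flip: nonempty_has_size)
  then have "?t \<le> ?s * ?t"
    by simp
  then show ?case
    using Mul unfolding weight.simps generators.simps size_union power2_sum by linarith
qed simp

text \<open>The error terms modulo which monomials are rewritten.\<close>

definition heavier :: "'a magma \<Rightarrow> 'a magma set" where
  "heavier m = {x. generators x = generators m \<and> weight m < weight x}"

text \<open>A factor and its heavier replacement have the same generators, so the product gains
  exactly the same weight.\<close>

lemma span_heavier_Mul_left:
  fixes v :: "('a, 'k::field) free_pre_lie"
  assumes "v \<in> free_pre_lie.span (free_monomial ` heavier s)"
  shows "v \<circ>\<^sub>P free_monomial t \<in> free_pre_lie.span (free_monomial ` heavier (Mul s t))"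
  using assms
proof (induction rule: free_pre_lie.span_induct_alt)
  case base
  then show ?case
    using free_pre_lie.mul_scale_left[of 0 0 "free_monomial t :: ('a, 'k) free_pre_lie"]
    by (simp add: free_pre_lie.span_zero)
next
  case (step c x y)
  then obtain s' where "s' \<in> heavier s" "x = free_monomial s'"
    by blast
  then have "x \<circ>\<^sub>P free_monomial t \<in> free_monomial ` heavier (Mul s t)"
    by (auto simp: heavier_def intro!: image_eqI[of _ _ "Mul s' t"])
  then show ?case
    using step by (auto simp: free_pre_lie.mul_add_left free_pre_lie.mul_scale_left
        intro!: free_pre_lie.span_add free_pre_lie.span_scale intro: free_pre_lie.span_base)
qed

lemma span_heavier_Mul_right:
  fixes v :: "('a, 'k::field) free_pre_lie"
  assumes "v \<in> free_pre_lie.span (free_monomial ` heavier t)"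
  shows "free_monomial s \<circ>\<^sub>P v \<in> free_pre_lie.span (free_monomial ` heavier (Mul s t))"
  using assms
proof (induction rule: free_pre_lie.span_induct_alt)
  case base
  then show ?case
    using free_pre_lie.mul_scale_right[of "free_monomial s :: ('a, 'k) free_pre_lie" 0 0]
    by (simp add: free_pre_lie.span_zero)
next
  case (step c x y)
  then obtain t' where "t' \<in> heavier t" "x = free_monomial t'"
    by blast
  then have "free_monomial s \<circ>\<^sub>P x \<in> free_monomial ` heavier (Mul s t)"
    by (auto simp: heavier_def intro!: image_eqI[of _ _ "Mul s t'"])
  then show ?case
    using step by (auto simp: free_pre_lie.mul_add_right free_pre_lie.mul_scale_right
        intro!: free_pre_lie.span_add free_pre_lie.span_scale intro: free_pre_lie.span_base)
qed

text \<open>By the pre-Lie identity, \<open>(s t) v - (s v) t\<close> equals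
  \<open>s (t v) - s (v t)\<close>, whose terms are heavier; the congruence rules preserve this. So
  NAP rewriting is valid up to heavier monomials.\<close>

lemma nap_free_monomial:
  assumes "nap m m'"
  shows "generators m' = generators m" "weight m' = weight m"
    and "(free_monomial m - free_monomial m' :: ('a, 'k::field) free_pre_lie)
      \<in> free_pre_lie.span (free_monomial ` heavier m)"
proof -
  have "generators m' = generators m \<and> weight m' = weight m \<and>
    (free_monomial m - free_monomial m' :: ('a, 'k) free_pre_lie)
      \<in> free_pre_lie.span (free_monomial ` heavier m)"
    using assms
  proof (induction rule: nap.induct)
    case (refl m)
    then show ?case by (simp add: free_pre_lie.span_zero)
  next
    case (trans m m' m'')
    then have "heavier m' = heavier m"
      by (simp add: heavier_def)
    then have "(free_monomial m - free_monomial m') + (free_monomial m' - free_monomial m'')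
        \<in> free_pre_lie.span (free_monomial ` heavier m :: ('a, 'k) free_pre_lie set)"
      using trans.IH by (intro free_pre_lie.span_add) simp_all
    then show ?case
      using trans.IH by simp
  next
    case (swap s t v)
    \<comment> \<open>The weights grow by the numbers of generators of \<open>v\<close> and of
      \<open>t\<close>, respectively.\<close>
    have "Mul s (Mul t v) \<in> heavier (Mul (Mul s t) v)" "Mul s (Mul v t) \<in> heavier (Mul (Mul s t) v)"
      by (auto simp: heavier_def simp flip: nonempty_has_size)
    then have "free_monomial (Mul s (Mul t v)) - free_monomial (Mul s (Mul v t))
        \<in> free_pre_lie.span (free_monomial ` heavier (Mul (Mul s t) v) :: ('a, 'k) free_pre_lie set)"
      by (intro free_pre_lie.span_diff free_pre_lie.span_base imageI)
    moreover have "free_monomial (Mul (Mul s t) v) - free_monomial (Mul (Mul s v) t) =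
        (free_monomial (Mul s (Mul t v)) - free_monomial (Mul s (Mul v t)) :: ('a, 'k) free_pre_lie)"
      using free_pre_lie.pre_lie[of "free_monomial s :: ('a, 'k) free_pre_lie" "free_monomial t"
          "free_monomial v"]
      by (simp add: algebra_simps)
    ultimately show ?case by simp
  next
    case (left s s' t)
    moreover have "free_monomial (Mul s t) - free_monomial (Mul s' t) =
        (free_monomial s - free_monomial s' :: ('a, 'k) free_pre_lie) \<circ>\<^sub>P free_monomial t"
      using free_pre_lie.mul_add_left[of "free_monomial s - free_monomial s'" "free_monomial s'"]
      by (simp add: algebra_simps)
    ultimately show ?case
      using span_heavier_Mul_left[of "free_monomial s - free_monomial s' :: ('a, 'k) free_pre_lie" s t]
      by simp
  next
    case (right t t' s)
    moreover have "free_monomial (Mul s t) - free_monomial (Mul s t') =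
        (free_monomial s \<circ>\<^sub>P (free_monomial t - free_monomial t') :: ('a, 'k) free_pre_lie)"
      using free_pre_lie.mul_add_right[of _ "free_monomial t - free_monomial t'" "free_monomial t'"]
      by (simp add: algebra_simps)
    ultimately show ?case
      using span_heavier_Mul_right[of "free_monomial t - free_monomial t' :: ('a, 'k) free_pre_lie" t s]
      by simp
  qed
  then show "generators m' = generators m" "weight m' = weight m"
    "(free_monomial m - free_monomial m' :: ('a, 'k) free_pre_lie)
      \<in> free_pre_lie.span (free_monomial ` heavier m)"
    by auto
qed

text \<open>
  Insertion of \<open>T\<close> into the left spine of \<open>S\<close>, whose right subtrees are sorted by their minima; the
  last conjunct keeps the Lyndon condition provable at the vertex above the insertion.
\<close>

lemma nap_insert_color_1:
  assumes "pointed_Lyndon S" "pointed_Lyndon T" "\<nu> S < \<nu> T"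
    and "set_mset (leaves S) \<inter> set_mset (leaves T) = {}" "is_internal S \<longrightarrow> color S"
  shows "\<exists>U. nap (Mul (tree_monomial S) (tree_monomial T)) (tree_monomial U) \<and> pointed_Lyndon U \<and>
    is_internal U \<and> color U \<and> \<nu> U = \<nu> S \<and>
    (\<forall>k. k < \<nu> T \<and> (is_internal S \<longrightarrow> k < \<nu> (right S)) \<longrightarrow> k < \<nu> (right U))"
  using assms
proof (induction S)
  case (Leaf a)
  have "nap (Mul (tree_monomial (Leaf a)) (tree_monomial T)) (tree_monomial (Node (Leaf a) True T))"
    by (simp add: nap.refl)
  with Leaf show ?case
    by (intro exI[of _ "Node (Leaf a) True T"]) (auto simp: pointed_Lyndon_Node)
next
  case (Node l u r)
  then have u: "u" and lr: "pointed_Lyndon l" "pointed_Lyndon r" "\<nu> l \<le> \<nu> r"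
    "is_internal l \<longrightarrow> color l \<and> \<nu> r < \<nu> (right l)"
    by (auto simp: pointed_Lyndon_Node)
  show ?case
  proof (cases "\<nu> T < \<nu> r")
    case True
    have "nap (Mul (tree_monomial (Node l u r)) (tree_monomial T))
        (tree_monomial (Node (Node l u r) True T))"
      by (simp add: nap.refl)
    with Node.prems True u lr show ?thesis
      by (intro exI[of _ "Node (Node l u r) True T"]) (auto simp: pointed_Lyndon_Node)
  next
    case False
    have "\<nu> r \<noteq> \<nu> T"
      using Node.prems(4) min_leaf_in[of r] min_leaf_in[of T] by auto
    then have less: "\<nu> r < \<nu> T"
      using False by simp
    then obtain U where U: "nap (Mul (tree_monomial l) (tree_monomial T)) (tree_monomial U)"
      "pointed_Lyndon U" "is_internal U" "color U" "\<nu> U = \<nu> l"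
      "\<And>k. k < \<nu> T \<and> (is_internal l \<longrightarrow> k < \<nu> (right l)) \<Longrightarrow> k < \<nu> (right U)"
      using Node.IH(1) Node.prems lr by auto
    have "nap (Mul (tree_monomial (Node l u r)) (tree_monomial T)) (tree_monomial (Node U True r))"
      using u nap.trans[OF nap.swap nap.left[OF U(1)]] by simp
    \<comment> \<open>The Lyndon inequality at the new root is the last property of \<open>U\<close>
      with \<open>k = \<nu> r\<close>.\<close>
    moreover have "pointed_Lyndon (Node U True r)"
      using U lr less by (simp add: pointed_Lyndon_Node)
    ultimately show ?thesis
      using U(5) by (intro exI[of _ "Node U True r"]) simp
  qed
qed

section \<open>Existence of pointed Lyndon forms\<close>

lemma count_generators_distinct: "distinct_gens m \<Longrightarrow> count (generators m) a \<le> 1"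
  by (subst generators_distinct) (simp_all add: count_mset_set')

text \<open>After both factors are put into normal form \<open>S\<close> and \<open>T\<close>, a
  smaller minimum in \<open>T\<close> calls for a root of color 0. Otherwise \<open>T\<close> is
  inserted into the spine of \<open>S\<close> if that has color 1, or is moved past the left subtree
  of \<open>S\<close> if that root has color 0.\<close>

lemma nap_pointed_Lyndon:
  assumes "distinct_gens m"
  shows "\<exists>T. nap m (tree_monomial T) \<and> pointed_Lyndon T"
  using assms
proof (induction "size (generators m)" arbitrary: m rule: less_induct)
  case less
  show ?case
  proof (cases m)
    case (Gen a)
    then have "nap m (tree_monomial (Leaf a)) \<and> pointed_Lyndon (Leaf a)"
      by (simp add: nap.refl)
    then show ?thesis ..
  next
    case (Mul s t)
    then obtain S T where S: "nap s (tree_monomial S)" "pointed_Lyndon S"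
      and T: "nap t (tree_monomial T)" "pointed_Lyndon T"
      using less.hyps[of s] less.hyps[of t] less.prems by (auto simp flip: nonempty_has_size)
    have leaves: "leaves S = generators s" "leaves T = generators t"
      using nap_free_monomial(1)[OF S(1)] nap_free_monomial(1)[OF T(1)] by simp_all
    have m: "nap m (Mul (tree_monomial S) (tree_monomial T))"
      unfolding Mul using nap.trans[OF nap.left[OF S(1)] nap.right[OF T(1)]] .
    have disj: "set_mset (leaves S) \<inter> set_mset (leaves T) = {}"
      using less.prems by (simp add: Mul leaves)
    have neq: "\<nu> S \<noteq> \<nu> T"
      using disj min_leaf_in[of S] min_leaf_in[of T] by auto
    consider "\<nu> T < \<nu> S" | "\<nu> S < \<nu> T" "is_internal S \<longrightarrow> color S"
      | L R where "\<nu> S < \<nu> T" "S = Node L False R"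
      using neq by (cases S) (auto simp: neq_iff)
    then show ?thesis
    proof cases
      case 1
      then have "pointed_Lyndon (Node T False S)"
        using S T by (simp add: pointed_Lyndon_Node)
      moreover have "nap m (tree_monomial (Node T False S))"
        using m by simp
      ultimately show ?thesis by blast
    next
      case 2
      then obtain U where "nap (Mul (tree_monomial S) (tree_monomial T)) (tree_monomial U)"
        "pointed_Lyndon U"
        using nap_insert_color_1[OF S(2) T(2) _ disj] by auto
      then show ?thesis
        using nap.trans[OF m] by blast
    next
      case 3
      \<comment> \<open>Here \<open>S\<close> stands for \<open>R L\<close>, and
        \<open>(R L) T\<close> is rewritten to \<open>(R T) L\<close>. The product
        \<open>R T\<close> is smaller, because the labels of \<open>L\<close> are gone.\<close>
      have "distinct_gens (Mul (tree_monomial R) (tree_monomial T))"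
      proof (rule distinct_gensI)
        fix a
        have "generators m = leaves S + leaves T"
          by (simp add: Mul leaves)
        then have "count (leaves S + leaves T) a \<le> 1"
          using count_generators_distinct[OF less.prems, of a] by simp
        then show "count (generators (Mul (tree_monomial R) (tree_monomial T))) a \<le> 1"
          by (simp add: 3)
      qed
      moreover have "size (generators (Mul (tree_monomial R) (tree_monomial T))) < size (generators m)"
        using leaves[symmetric] by (simp add: Mul 3 flip: nonempty_has_size)
      ultimately obtain W where W: "nap (Mul (tree_monomial R) (tree_monomial T)) (tree_monomial W)"
        "pointed_Lyndon W"
        using less.hyps by blast
      have "leaves W = leaves R + leaves T"
        using nap_free_monomial(1)[OF W(1)] by simp
      \<comment> \<open>Normalization needs \<open>\<nu> L \<le> \<nu> W\<close>, which follows
        since \<open>\<nu> L = \<nu> S\<close> is below both \<open>\<nu> R\<close> and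
        \<open>\<nu> T\<close>.\<close>
      then have "\<nu> W = \<nu> R \<or> \<nu> W \<ge> \<nu> T"
        using min_leaf_in[of W] min_leaf_le[of "\<nu> W"] min_leaf_le[of "\<nu> R" W] min_leaf_in[of R]
        by (metis antisym union_iff)
      then have "pointed_Lyndon (Node L False W)"
        using 3 S(2) W(2) by (auto simp: pointed_Lyndon_Node)
      moreover have "nap m (tree_monomial (Node L False W))"
        using nap.trans[OF m] nap.trans[OF nap.swap nap.left[OF W(1)]] by (simp add: 3)
      ultimately show ?thesis by blast
    qed
  qed
qed

section \<open>The basis\<close>

lemma TLyn_iff: "T \<in> TLyn n \<longleftrightarrow> leaves T = mset_set {1..n} \<and> pointed_Lyndon T"
  by (simp add: TLyn_def bicolored_tree_on_def)

text \<open>Rewriting leaves errors of larger weight only, and \<open>weight_le\<close> bounds the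
  weight, so the induction runs on the remaining gap.\<close>

lemma free_monomial_in_span_Theta:
  assumes "generators m = mset_set {1..n}"
  shows "(free_monomial m :: (nat, 'k::field) free_pre_lie)
    \<in> free_pre_lie.span {Theta T |T. T \<in> TLyn n}"
  using assms
proof (induction "(size (mset_set {1..n}))\<^sup>2 - weight m" arbitrary: m rule: less_induct)
  case less
  let ?B = "{Theta T |T. T \<in> TLyn n} :: (nat, 'k) free_pre_lie set"
  obtain T where T: "nap m (tree_monomial T)" "pointed_Lyndon T"
    using nap_pointed_Lyndon distinct_gens_mset_set[OF less.prems] by blast
  have "leaves T = mset_set {1..n}"
    using nap_free_monomial(1)[OF T(1)] less.prems by simp
  then have "T \<in> TLyn n"
    using T by (simp add: TLyn_iff)
  then have "free_monomial (tree_monomial T) \<in> free_pre_lie.span ?B"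
    unfolding Theta_eq_free_monomial[symmetric] by (blast intro: free_pre_lie.span_base)
  moreover have "free_monomial ` heavier m \<subseteq> free_pre_lie.span ?B"
  proof (intro image_subsetI)
    fix x assume "x \<in> heavier m"
    \<comment> \<open>Truncated subtraction decreases strictly because \<open>weight m\<close> is
      below \<open>weight x\<close> and hence below the bound.\<close>
    then show "free_monomial x \<in> free_pre_lie.span ?B"
      using less.prems weight_le[of x] by (intro less.hyps diff_less_mono2) (simp_all add: heavier_def)
  qed
  then have "free_pre_lie.span (free_monomial ` heavier m) \<subseteq> free_pre_lie.span ?B"
    by (intro free_pre_lie.span_minimal) simp_all
  then have "free_monomial m - free_monomial (tree_monomial T) \<in> free_pre_lie.span ?B"
    using nap_free_monomial(3)[OF T(1)] by blast
  ultimately have "free_monomial m - free_monomial (tree_monomial T) + free_monomial (tree_monomial T)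
      \<in> free_pre_lie.span ?B"
    by (rule free_pre_lie.span_add[rotated])
  then show ?case
    by simp
qed

text \<open>In a linear relation mapped to trees, a leading tree of minimal depth occurs in only one
  term, with coefficient 1.\<close>

lemma independent_Theta:
  "free_pre_lie.independent ({Theta T |T. T \<in> TLyn n} :: (nat, 'k::field) free_pre_lie set)"
proof
  let ?B = "{Theta T |T. T \<in> TLyn n} :: (nat, 'k) free_pre_lie set"
  assume "free_pre_lie.dependent ?B"
  then obtain A c v where A: "finite A" "A \<subseteq> ?B" "(\<Sum>v\<in>A. free_scale (c v) v) = 0" "v \<in> A" "c v \<noteq> 0"
    unfolding free_pre_lie.dependent_explicit by blast
  \<comment> \<open>Independence concerns a set of vectors, so each vector is given one chosen tree
    that represents it.\<close>
  define tr where "tr v = (SOME T. v = Theta T \<and> T \<in> TLyn n)" for v :: "(nat, 'k) free_pre_lie"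
  have "v = Theta (tr v) \<and> tr v \<in> TLyn n" if "v \<in> A" for v
    unfolding tr_def by (rule someI_ex) (use A(2) that in blast)
  then have Theta_tr: "free_monomial (tree_monomial (tr v)) = v"
    and tr: "leaves (tr v) = mset_set {1..n}" "pointed_Lyndon (tr v)" if "v \<in> A" for v
    using that unfolding Theta_eq_free_monomial TLyn_iff by metis+
  define lt where "lt v = leading_tree (tree_monomial (tr v))" for v
  have dist: "distinct_gens (tree_monomial (tr v))" if "v \<in> A" for v
    using tr(1)[OF that] by (intro distinct_gens_mset_set) simp
  have inj: "v = w" if "v \<in> A" "w \<in> A" "lt v = lt w" for v w
  proof -
    have "tr v = tr w"
      using leading_tree_inject[OF tr(2) dist tr(2) dist] that by (simp add: lt_def)
    then show ?thesis
      using Theta_tr that by metis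
  qed
  \<comment> \<open>The coefficient of \<open>lt w\<close> is compared below; minimality among the
    vectors with nonzero coefficient isolates \<open>w\<close>.\<close>
  obtain w where w: "w \<in> A" "c w \<noteq> 0" and min: "\<And>v. v \<in> A \<Longrightarrow> c v \<noteq> 0 \<Longrightarrow> card (lt w) \<le> card (lt v)"
    using A(4,5) ex_has_least_nat[of "\<lambda>v. v \<in> A \<and> c v \<noteq> 0" v "\<lambda>v. card (lt v)"] by blast
  have "\<exists>h. pre_lie_hom_on tree_scale tree_mult (free_pre_lie_on UNIV) h \<and>
      (\<forall>a\<in>UNIV. h (free_gen a :: (nat, 'k) free_pre_lie) = Poly_Mapping.single {(a, a)} 1)"
    by (rule free_pre_lie_on_universal(1)[OF tree.pre_lie_algebra_axioms])
  then obtain h :: "(nat, 'k) free_pre_lie \<Rightarrow> nat rel \<Rightarrow>\<^sub>0 'k"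
    where hom: "pre_lie_hom_on tree_scale tree_mult (free_pre_lie_on UNIV) h"
      and h_gen: "\<And>a. h (free_gen a) = Poly_Mapping.single {(a, a)} 1"
    by (elim exE conjE) simp
  note in_free = free_monomial_in_free_pre_lie_on[OF subset_UNIV]
  have h_add: "h (x + y) = h x + h y" and h_mult: "h (x \<circ>\<^sub>P y) = tree_mult (h x) (h y)"
    if "x \<in> free_pre_lie_on UNIV" "y \<in> free_pre_lie_on UNIV" for x y
    using hom that unfolding pre_lie_hom_on_def by blast+
  have h_scale: "h (free_scale a x) = tree_scale a (h x)" if "x \<in> free_pre_lie_on UNIV" for a x
    using hom that unfolding pre_lie_hom_on_def by blast
  have h_mono: "h (free_monomial m) = expansion m" for m
    by (induction m) (simp_all add: h_gen h_mult in_free)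
  have h0: "h 0 = 0"
    using h_add[OF free_pre_lie_on.zero free_pre_lie_on.zero] by simp
  have v_in: "v \<in> free_pre_lie_on UNIV" if "v \<in> A" for v
    using Theta_tr[OF that] in_free by metis
  \<comment> \<open>Membership is carried along because \<open>h\<close> is known to be a
    homomorphism only on \<open>free_pre_lie_on UNIV\<close>.\<close>
  have "(\<Sum>v\<in>A'. free_scale (c v) v) \<in> free_pre_lie_on UNIV \<and>
      h (\<Sum>v\<in>A'. free_scale (c v) v) = (\<Sum>v\<in>A'. tree_scale (c v) (h v))" if "A' \<subseteq> A" for A'
    using finite_subset[OF that A(1)] that
  proof (induction A' rule: finite_induct)
    case empty
    then show ?case by (simp add: h0 free_pre_lie_on.zero)
  next
    case (insert v A')
    then show ?case
      using v_in[of v] by (simp add: h_add h_scale free_pre_lie_on.add free_pre_lie_on.scale)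
  qed
  from this[OF order_refl] have "(\<Sum>v\<in>A. tree_scale (c v) (h v)) = 0"
    using A(3) h0 by simp
  then have "0 = Poly_Mapping.lookup (\<Sum>v\<in>A. tree_scale (c v) (h v)) (lt w)"
    by simp
  also have "\<dots> = (\<Sum>v\<in>A. c v * Poly_Mapping.lookup (h v) (lt w))"
    by (simp add: lookup_sum)
  also have "\<dots> = (\<Sum>v\<in>A. if v = w then c w else 0)"
  proof (rule sum.cong[OF HOL.refl])
    fix v assume v: "v \<in> A"
    have hv: "h v = expansion (tree_monomial (tr v))"
      using Theta_tr[OF v] h_mono by metis
    have keys: "lt w = lt v \<or> card (lt v) < card (lt w)" if "lt w \<in> Poly_Mapping.keys (h v)"
      using expansion_leading_tree(1)[OF dist[OF v]] that unfolding hv lt_def by blast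
    have one: "Poly_Mapping.lookup (h v) (lt v) = 1"
      unfolding hv lt_def by (rule expansion_leading_tree(2)[OF dist[OF v]])
    show "c v * Poly_Mapping.lookup (h v) (lt w) = (if v = w then c w else 0)"
    proof (cases "v = w \<or> c v = 0")
      case True
      then show ?thesis
        using one by auto
    next
      case False
      \<comment> \<open>If it occurred, \<open>lt w\<close> would equal \<open>lt v\<close>, against
        injectivity, or be strictly deeper than \<open>lt v\<close>, against the choice of
        \<open>w\<close>.\<close>
      then have "lt w \<notin> Poly_Mapping.keys (h v)"
        using keys min[OF v] inj[OF v w(1)] by fastforce
      then show ?thesis
        using False by (simp add: in_keys_iff)
    qed
  qed
  also have "\<dots> = c w"
    using A(1) w by simp
  finally show False
    using w by simp
qed

theorem theorem4p4:
  fixes n :: nat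
  assumes "n \<ge> 1"
  shows "basis_of {Theta T |T. T \<in> TLyn n} (PreLie n :: (nat, 'k::field) free_pre_lie set)"
  unfolding basis_of_def
proof (intro conjI independent_Theta antisym)
  show "free_pre_lie.span {Theta T |T. T \<in> TLyn n} \<subseteq> (PreLie n :: (nat, 'k) free_pre_lie set)"
    unfolding PreLie_def Theta_eq_free_monomial
    by (intro free_pre_lie.span_mono) (auto simp: TLyn_iff)
  show "(PreLie n :: (nat, 'k) free_pre_lie set) \<subseteq> free_pre_lie.span {Theta T |T. T \<in> TLyn n}"
    unfolding PreLie_def
    by (rule free_pre_lie.span_minimal) (auto intro: free_monomial_in_span_Theta)
qed

end
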